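(* For every fixed integer $K\geq 3$ there exists a constant $C$ such that $s(G)\leq K$ for every graph $G$ of order $n\geq 2$ with minimum degree $$\delta(G)\geq \left(\frac{1}{K-1}+\frac{C}{\left(\frac{n}{\ln n}\right)^{1/6}}\right)n.$$
   Context: All graphs are finite and simple. For a graph $G=(V,E)$ and a positive integer $k$, a $k$-weighting is a map $\omega:E\to\{1,2,\ldots,k\}$; the weighted degree of a vertex $v$ is $\sigma_\omega(v)=\sum_{u\in N(v)}\omega(uv)$, where $N(v)$ is the set of neighbours of $v$. The irregularity strength $s(G)$ is the least $k$ such that there exists a $k$-weighting of $G$ for which all vertices have pairwise distinct weighted degrees; if no such $k$ exists (which happens exactly when $G$ has an isolated edge or more than one isolated vertex), $s(G)=+\infty$. Here $\delta(G)$ denotes the minimum degree of $G$ and $\ln$ is the natural logarithm. *)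

theory Defs
  imports Complex_Main "HOL-Library.Extended_Nat"
begin

(* Every finite graph is isomorphic to one with vertex type nat, so a bound that is uniform over
   all graphs with that vertex type is uniform over all finite graphs. *)
definition simple_graph :: "'a set \<Rightarrow> 'a set set \<Rightarrow> bool" where
  "simple_graph V E \<longleftrightarrow> finite V \<and> (\<forall>e\<in>E. e \<subseteq> V \<and> card e = 2)"

definition neighbours :: "'a set set \<Rightarrow> 'a \<Rightarrow> 'a set" where
  "neighbours E v = {u. {u, v} \<in> E}"

definition graph_degree :: "'a set set \<Rightarrow> 'a \<Rightarrow> nat" where
  "graph_degree E v = card (neighbours E v)"

(* Meaningful only for nonempty finite V. *)
definition min_degree :: "'a set \<Rightarrow> 'a set set \<Rightarrow> nat" where
  "min_degree V E = Min (graph_degree E ` V)"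

(* Only the values of \<omega> on E matter. *)
definition weighting :: "'a set set \<Rightarrow> nat \<Rightarrow> ('a set \<Rightarrow> nat) \<Rightarrow> bool" where
  "weighting E k \<omega> \<longleftrightarrow> (\<forall>e\<in>E. \<omega> e \<in> {1..k})"

definition weighted_degree :: "'a set set \<Rightarrow> ('a set \<Rightarrow> nat) \<Rightarrow> 'a \<Rightarrow> nat" where
  "weighted_degree E \<omega> v = (\<Sum>u\<in>neighbours E v. \<omega> {u, v})"

(* The infimum of the empty set in enat is \<infinity>, which covers graphs admitting no such
   weighting; a nonempty set of extended naturals contains its infimum. *)
definition irregularity_strength :: "'a set \<Rightarrow> 'a set set \<Rightarrow> enat" where
  "irregularity_strength V E =
     Inf {enat k | k. k \<ge> 1 \<and> (\<exists>\<omega>. weighting E k \<omega> \<and> inj_on (weighted_degree E \<omega>) V)}"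

end

theory Submission imports Defs begin

text \<open>Put \<open>\<epsilon> = C (ln n / n) powr (1/6)\<close>, so that \<open>\<epsilon>\<^sup>3 n\<close> is a large multiple
  of the scale \<open>D = sqrt (n ln n)\<close> of random fluctuations. Give each vertex \<open>v\<close> a uniform label \<open>x v\<close>
  in \<open>[0, 1]\<close>, and an edge \<open>uv\<close> the weight \<open>K\<close> if \<open>x u + x v \<ge> 1\<close> and \<open>1\<close> otherwise. The weighted degree
  of \<open>v\<close> is then within \<open>O(D)\<close> of \<open>d(v) (1 + (K - 1) x v)\<close>, and because \<open>(K - 1) d(v) > (1 + \<epsilon>) n\<close> the
  weighted degrees have density less than \<open>1 - \<epsilon>/2\<close>: there are enough integers to move each of them to
  a private slot at distance \<open>O(D)\<close>.

  To move them, a proportion \<open>O(\<epsilon>)\<close> of the edges is set aside with weight \<open>2\<close>. Replacing the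
  weights of \<open>uw\<close> and \<open>vw\<close> by \<open>2 \<plusminus> 1\<close> and \<open>2 \<mp> 1\<close> transfers one unit between \<open>u\<close> and \<open>v\<close> without affecting
  the common neighbour \<open>w\<close>. Among any \<open>K\<close> vertices two have at least \<open>n / K\<^sup>3\<close> common neighbours, so
  the vertices are covered by fewer than \<open>K\<close> paths whose consecutive members can exchange
  \<open>\<Omega>(\<epsilon>\<^sup>2 n)\<close> units. Along a path the displacements add up; every \<open>\<Theta>(1/\<epsilon>)\<close>-th vertex owns two slots, at
  distance \<open>W = \<Theta>(D/\<epsilon>)\<close> on either side, and chooses between them so that the running sum stays
  \<open>O(W) = O(\<epsilon>\<^sup>2 n)\<close>; this balance is where the exponent \<open>1/6\<close> comes from.\<close>

section \<open>Balanced functions by a potential argument\<close>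

text \<open>For \<open>y = -z\<close> with \<open>z > 0\<close> the second-order Taylor bound on
  \<open>exp z\<close> gives \<open>(1 - z + z^2) * exp z >= 1\<close>, and division by
  \<open>exp z\<close> yields the claim; for \<open>y >= 0\<close> it is the library bound.\<close>

lemma exp_le_quadratic:
  fixes y :: real
  assumes "\<bar>y\<bar> \<le> 1"
  shows "exp y \<le> 1 + y + y\<^sup>2"
proof (cases "y \<ge> 0")
  case True
  then show ?thesis using assms exp_bound[of y] by simp
next
  case False
  define z where "z = - y"
  have z: "z > 0" "z \<le> 1" using False assms by (auto simp: z_def)
  have low: "1 + z + z\<^sup>2/2 \<le> exp z"
    using exp_lower_Taylor_quadratic[of z] z by simp
  have "(1 - z + z\<^sup>2) * (1 + z + z\<^sup>2/2) = 1 + z^2/2 + z^3/2 + z^4/2"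
    by (simp add: field_simps power2_eq_square power3_eq_cube power4_eq_xxxx)
  also have "\<dots> \<ge> 1" using z by simp
  finally have "1 \<le> (1 - z + z\<^sup>2) * (1 + z + z\<^sup>2/2)" .
  also have "\<dots> \<le> (1 - z + z\<^sup>2) * exp z"
    using low z by (intro mult_left_mono) (auto simp: power2_eq_square)
  finally have "exp (- z) \<le> 1 - z + z\<^sup>2"
    by (simp add: exp_minus field_simps)
  then show ?thesis by (simp add: z_def)
qed

text \<open>The method of conditional expectations: values are fixed one vertex at a time. Since
  \<open>z j v\<close> has mean zero and modulus at most 1, averaging over the choice at
  \<open>v\<close> multiplies each term by at most \<open>exp (l^2)\<close>, so some choice
  multiplies the whole potential by no more than that. Keeping all tests \<open>j\<close> in one sum
  replaces a union bound.\<close>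

lemma exists_low_potential:
  fixes z :: "'j \<Rightarrow> 'a \<Rightarrow> 'x \<Rightarrow> real" and l :: real
  assumes "finite V" "finite X" "X \<noteq> {}" "finite J" "0 \<le> l" "l \<le> 1"
    and "\<And>j v x. j \<in> J \<Longrightarrow> v \<in> V \<Longrightarrow> x \<in> X \<Longrightarrow> \<bar>z j v x\<bar> \<le> 1"
    and "\<And>j v. j \<in> J \<Longrightarrow> v \<in> V \<Longrightarrow> (\<Sum>x\<in>X. z j v x) = 0"
  shows "\<exists>f. (\<forall>v\<in>V. f v \<in> X) \<and>
           (\<Sum>j\<in>J. exp (l * (\<Sum>v\<in>V. z j v (f v)))) \<le> card J * exp (l\<^sup>2 * card V)"
  using assms(1,7,8)
proof (induction V rule: finite_induct)
  case empty
  then show ?case by simp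
next
  case (insert v V)
  have "\<exists>f. (\<forall>v\<in>V. f v \<in> X) \<and>
      (\<Sum>j\<in>J. exp (l * (\<Sum>v\<in>V. z j v (f v)))) \<le> card J * exp (l\<^sup>2 * card V)"
    by (rule insert.IH) (use insert.prems in auto)
  then obtain f where f: "\<forall>v\<in>V. f v \<in> X"
    "(\<Sum>j\<in>J. exp (l * (\<Sum>v\<in>V. z j v (f v)))) \<le> card J * exp (l\<^sup>2 * card V)"
    by blast
  define a where "a j = exp (l * (\<Sum>v\<in>V. z j v (f v)))" for j
  define S where "S = (\<Sum>j\<in>J. a j)"
  have one: "(\<Sum>x\<in>X. exp (l * z j v x)) \<le> card X * exp (l\<^sup>2)" if "j \<in> J" for j
  proof -
    have "exp (l * z j v x) \<le> 1 + l * z j v x + l\<^sup>2" if "x \<in> X" for x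
    proof -
      have b: "\<bar>z j v x\<bar> \<le> 1" using insert.prems(1) \<open>j \<in> J\<close> that by simp
      have "\<bar>l * z j v x\<bar> \<le> 1" using b assms(5,6) by (simp add: abs_mult mult_le_one)
      then have "exp (l * z j v x) \<le> 1 + l * z j v x + (l * z j v x)\<^sup>2"
        by (rule exp_le_quadratic)
      moreover have "(l * z j v x)\<^sup>2 \<le> l\<^sup>2"
        using b by (simp add: power_mult_distrib mult_left_le abs_square_le_1)
      ultimately show ?thesis by linarith
    qed
    then have "(\<Sum>x\<in>X. exp (l * z j v x)) \<le> (\<Sum>x\<in>X. 1 + l * z j v x + l\<^sup>2)"
      by (rule sum_mono)
    also have "\<dots> = card X * (1 + l\<^sup>2) + l * (\<Sum>x\<in>X. z j v x)"
      by (simp add: sum.distrib sum_distrib_left algebra_simps)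
    also have "\<dots> = card X * (1 + l\<^sup>2)" using insert.prems(2) that by simp
    also have "\<dots> \<le> card X * exp (l\<^sup>2)"
      by (intro mult_left_mono exp_ge_add_one_self) simp_all
    finally show ?thesis .
  qed
  have "(\<Sum>x\<in>X. \<Sum>j\<in>J. a j * exp (l * z j v x)) = (\<Sum>j\<in>J. a j * (\<Sum>x\<in>X. exp (l * z j v x)))"
    by (subst sum.swap) (simp add: sum_distrib_left)
  also have "\<dots> \<le> (\<Sum>j\<in>J. a j * (card X * exp (l\<^sup>2)))"
    by (intro sum_mono mult_left_mono one) (simp_all add: a_def)
  also have "\<dots> = (\<Sum>x\<in>X. exp (l\<^sup>2) * S)"
    by (simp add: S_def sum_distrib_left sum_distrib_right algebra_simps)
  finally have le: "(\<Sum>x\<in>X. \<Sum>j\<in>J. a j * exp (l * z j v x)) \<le> (\<Sum>x\<in>X. exp (l\<^sup>2) * S)" .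
  have "\<exists>x\<in>X. (\<Sum>j\<in>J. a j * exp (l * z j v x)) \<le> exp (l\<^sup>2) * S"
  proof (rule ccontr)
    assume "\<not> ?thesis"
    then have "(\<Sum>x\<in>X. exp (l\<^sup>2) * S) < (\<Sum>x\<in>X. \<Sum>j\<in>J. a j * exp (l * z j v x))"
      using assms(2,3) by (intro sum_strict_mono) auto
    then show False using le by simp
  qed
  then obtain x where x: "x \<in> X" "(\<Sum>j\<in>J. a j * exp (l * z j v x)) \<le> exp (l\<^sup>2) * S" by blast
  have eq: "(\<Sum>u\<in>insert v V. z j u ((f(v := x)) u)) = z j v x + (\<Sum>u\<in>V. z j u (f u))" for j
    using insert.hyps by (auto intro!: sum.cong)
  have "(\<Sum>j\<in>J. exp (l * (\<Sum>u\<in>insert v V. z j u ((f(v := x)) u)))) =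
        (\<Sum>j\<in>J. a j * exp (l * z j v x))"
    unfolding eq by (simp add: a_def distrib_left exp_add mult.commute)
  also have "\<dots> \<le> exp (l\<^sup>2) * (card J * exp (l\<^sup>2 * card V))"
  proof -
    have "exp (l\<^sup>2) * S \<le> exp (l\<^sup>2) * (card J * exp (l\<^sup>2 * card V))"
      using f(2) by (intro mult_left_mono) (simp_all add: S_def a_def)
    then show ?thesis using x(2) by linarith
  qed
  also have "\<dots> = card J * exp (l\<^sup>2 * card (insert v V))"
    using insert.hyps by (simp add: algebra_simps exp_add)
  finally show ?case using x(1) f(1) insert.hyps
    by (intro exI[of _ "f(v := x)"]) auto
qed

text \<open>A Hoeffding bound with union bound in deterministic form: every term of the potential is
  at most the whole, hence at most \<open>exp (2 * L)\<close>, which caps each deviation by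
  \<open>2 * L / l\<close>.\<close>

lemma exists_balanced_function:
  fixes H :: "('a \<Rightarrow> 'x \<Rightarrow> real) set" and L :: real
  assumes "finite V" "V \<noteq> {}" "finite X" "X \<noteq> {}" "finite H"
    and H01: "\<And>h v x. h \<in> H \<Longrightarrow> v \<in> V \<Longrightarrow> x \<in> X \<Longrightarrow> 0 \<le> h v x \<and> h v x \<le> 1"
    and L: "2 * real (card H) \<le> exp L" "0 < L" "L \<le> card V"
  shows "\<exists>f. (\<forall>v\<in>V. f v \<in> X) \<and>
           (\<forall>h\<in>H. \<bar>(\<Sum>v\<in>V. h v (f v)) - (\<Sum>v\<in>V. (\<Sum>x\<in>X. h v x) / card X)\<bar> \<le> 2 * sqrt (card V * L))"
proof -
  define n where "n = real (card V)"
  have n: "n > 0" using assms(1,2) by (simp add: n_def card_gt_0_iff)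
  \<comment> \<open>This \<open>l\<close> makes \<open>l^2 * n = L\<close>, so that the growth of
    the potential matches the bound on the number of tests and
    \<open>2 * L / l = 2 * sqrt (n * L)\<close>; \<open>L <= n\<close> keeps
    \<open>l <= 1\<close>.\<close>
  define l where "l = sqrt (L / n)"
  have l: "0 < l" "l \<le> 1" using L n by (auto simp: l_def n_def)
  define avg where "avg h v = (\<Sum>x\<in>X. h v x) / card X" for h :: "'a \<Rightarrow> 'x \<Rightarrow> real" and v
  \<comment> \<open>The sign \<open>snd j\<close> turns each function into two tests, so that
    deviations in both directions are controlled.\<close>
  define z where "z j v x = snd j * (fst j v x - avg (fst j) v)" for j :: "('a \<Rightarrow> 'x \<Rightarrow> real) \<times> real" and v x
  have cX: "real (card X) > 0" using assms(3,4) by (simp add: card_gt_0_iff)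
  have avg01: "0 \<le> avg h v \<and> avg h v \<le> 1" if "h \<in> H" "v \<in> V" for h v
  proof -
    have "(\<Sum>x\<in>X. h v x) \<le> (\<Sum>x\<in>X. 1)" using H01 that by (intro sum_mono) auto
    moreover have "0 \<le> (\<Sum>x\<in>X. h v x)" using H01 that by (intro sum_nonneg) auto
    ultimately show ?thesis using cX by (simp add: avg_def)
  qed
  have "\<exists>f. (\<forall>v\<in>V. f v \<in> X) \<and>
           (\<Sum>j\<in>H \<times> {1,-1}. exp (l * (\<Sum>v\<in>V. z j v (f v)))) \<le> card (H \<times> {1,-1::real}) * exp (l\<^sup>2 * card V)"
  proof (rule exists_low_potential)
    fix j :: "('a \<Rightarrow> 'x \<Rightarrow> real) \<times> real" and v x
    assume *: "j \<in> H \<times> {1,-1}" "v \<in> V"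
    then have j: "fst j \<in> H" "snd j = 1 \<or> snd j = -1" by auto
    { assume "x \<in> X"
      then have "0 \<le> fst j v x \<and> fst j v x \<le> 1" using H01 j(1) *(2) by blast
      then show "\<bar>z j v x\<bar> \<le> 1" using avg01[OF j(1) *(2)] j(2) by (auto simp: z_def) }
    show "(\<Sum>x\<in>X. z j v x) = 0"
      using cX by (simp add: z_def sum_distrib_left[symmetric] sum_subtractf avg_def)
  qed (use assms l in auto)
  then obtain f where f: "\<forall>v\<in>V. f v \<in> X"
    "(\<Sum>j\<in>H \<times> {1,-1}. exp (l * (\<Sum>v\<in>V. z j v (f v)))) \<le> card (H \<times> {1,-1::real}) * exp (l\<^sup>2 * card V)"
    by blast
  have l2: "l\<^sup>2 * n = L" using L n by (simp add: l_def)
  have bound: "l * (\<Sum>v\<in>V. z j v (f v)) \<le> 2 * L" if "j \<in> H \<times> {1,-1}" for j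
  proof -
    have "exp (l * (\<Sum>v\<in>V. z j v (f v))) \<le> (\<Sum>j\<in>H \<times> {1,-1}. exp (l * (\<Sum>v\<in>V. z j v (f v))))"
      using that assms(5) by (intro member_le_sum) auto
    also have "\<dots> \<le> card (H \<times> {1,-1::real}) * exp (l\<^sup>2 * card V)" by (rule f(2))
    also have "\<dots> = (2 * card H) * exp L"
      using l2 by (simp add: card_cartesian_product n_def mult.commute)
    also have "\<dots> \<le> exp L * exp L" using L(1) by (intro mult_right_mono) auto
    also have "\<dots> = exp (2 * L)" by (simp add: exp_add[symmetric])
    finally show ?thesis by simp
  qed
  have "2 * L / l = 2 * sqrt (n * L)"
  proof -
    have "l * sqrt (n * L) = sqrt (L / n * (n * L))" unfolding l_def by (rule real_sqrt_mult[symmetric])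
    also have "\<dots> = sqrt (L * L)" using n by simp
    also have "\<dots> = L" using L by simp
    finally show ?thesis using l by (simp add: field_simps)
  qed
  then have bound': "(\<Sum>v\<in>V. z j v (f v)) \<le> 2 * sqrt (n * L)" if "j \<in> H \<times> {1,-1}" for j
    using bound[OF that] l by (metis mult.commute pos_le_divide_eq)
  have "\<bar>(\<Sum>v\<in>V. h v (f v)) - (\<Sum>v\<in>V. avg h v)\<bar> \<le> 2 * sqrt (n * L)" if "h \<in> H" for h
    using bound'[of "(h, 1)"] bound'[of "(h, -1)"] that
    by (simp add: z_def sum_subtractf sum_negf)
  then show ?thesis using f(1) by (auto simp: avg_def n_def)
qed

section \<open>Path covers\<close>

definition path_system :: "('a \<Rightarrow> 'a \<Rightarrow> bool) \<Rightarrow> 'a set \<Rightarrow> 'a list set \<Rightarrow> bool" where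
  "path_system H V P \<longleftrightarrow> finite P \<and> (\<Union>p\<in>P. set p) = V \<and>
     (\<forall>p\<in>P. p \<noteq> [] \<and> distinct p \<and> successively H p) \<and>
     (\<forall>p\<in>P. \<forall>q\<in>P. p \<noteq> q \<longrightarrow> set p \<inter> set q = {})"

definition singleton_paths :: "'a list set \<Rightarrow> 'a list set" where
  "singleton_paths P = {p \<in> P. length p = 1}"

text \<open>One surgery step: two paths are exchanged for \<open>r\<close> and \<open>s\<close> on
  the same vertices. Allowing \<open>s = []\<close>, which \<open>{s} - {[]}\<close> discards,
  covers merging two paths as well as recutting them.\<close>

lemma path_system_replace2:
  assumes P: "path_system H V P" and "p \<in> P" "q \<in> P" "p \<noteq> q"
    and r: "r \<noteq> []" "distinct r" "successively H r"
    and s: "s = [] \<or> (distinct s \<and> successively H s)" "set r \<inter> set s = {}"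
    and rs: "set r \<union> set s = set p \<union> set q"
  shows "path_system H V (insert r (({s} - {[]}) \<union> (P - {p,q})))"
proof -
  have disj: "set x \<inter> set p = {}" "set x \<inter> set q = {}" if "x \<in> P - {p,q}" for x
    using P assms(2-4) that unfolding path_system_def by blast+
  have V: "(\<Union>x\<in>P. set x) = V" using P by (auto simp: path_system_def)
  have "(\<Union>x\<in>insert r (({s} - {[]}) \<union> (P - {p,q})). set x) = set r \<union> set s \<union> (\<Union>x\<in>P - {p,q}. set x)"
    by (cases "s = []") auto
  also have "\<dots> = (\<Union>x\<in>P. set x)" unfolding rs using assms(2,3) by blast
  finally have 1: "(\<Union>x\<in>insert r (({s} - {[]}) \<union> (P - {p,q})). set x) = V" using V by simp
  have 2: "set x \<inter> set y = {}" if "x \<in> insert r (({s} - {[]}) \<union> (P - {p,q}))"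
    "y \<in> insert r (({s} - {[]}) \<union> (P - {p,q}))" "x \<noteq> y" for x y
  proof -
    have a: "set x \<inter> set r = {}" "set x \<inter> set s = {}" "set r \<inter> set x = {}" "set s \<inter> set x = {}" if "x \<in> P - {p,q}" for x
      using disj[OF that] rs by blast+
    have b: "set x \<inter> set y = {}" if "x \<in> P - {p,q}" "y \<in> P - {p,q}" "x \<noteq> y" for x y
      using P that by (auto simp: path_system_def)
    from that have x: "x = r \<or> x = s \<or> x \<in> P - {p,q}" and y: "y = r \<or> y = s \<or> y \<in> P - {p,q}"
      by auto
    show ?thesis using x y
    proof (elim disjE)
      assume "x \<in> P - {p,q}" "y \<in> P - {p,q}"
      then show ?thesis using b that by simp
    qed (use that a s(2) in \<open>auto simp only: Int_commute\<close>)
  qed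
  show ?thesis unfolding path_system_def
    using P 1 2 r s(1) by (auto simp: path_system_def)
qed

lemma successively_rev_sym:
  assumes "\<And>x y. H x y \<Longrightarrow> H y x" "successively H p"
  shows "successively H (rev p)"
  using assms by (auto intro: successively_mono)

lemma path_system_singletons:
  assumes "finite V"
  shows "path_system H V ((\<lambda>v. [v]) ` V)"
  using assms by (auto simp: path_system_def)

text \<open>A system minimising the number of paths plus the number of singletons works. An edge
  between the last vertices of two paths would merge them, so these ends are independent and there
  are fewer than \<open>K\<close> paths. If \<open>[z]\<close> is a path, every neighbour of
  \<open>z\<close> is the second vertex of its path, which allows at most \<open>card P < K\<close>
  neighbours, contrary to the degree condition.\<close>

lemma path_cover:
  assumes fin: "finite V" and sym: "\<And>x y. H x y \<Longrightarrow> H y x" and irr: "\<And>x. \<not> H x x"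
    and HV: "\<And>x y. H x y \<Longrightarrow> y \<in> V"
    and indep: "\<And>A. A \<subseteq> V \<Longrightarrow> card A = K \<Longrightarrow> \<exists>x\<in>A. \<exists>y\<in>A. H x y"
    and deg: "\<And>v. v \<in> V \<Longrightarrow> K \<le> card {u. H v u}"
    and K: "K > 0"
  shows "\<exists>P. path_system H V P \<and> card P < K \<and> (\<forall>p\<in>P. 2 \<le> length p)"
proof -
  \<comment> \<open>Singletons count twice, so that a surgery keeping the number of paths but
    absorbing a singleton still lowers \<open>m\<close>.\<close>
  define m where "m P = card P + card (singleton_paths P)" for P :: "'a list set"
  obtain P where P: "path_system H V P" and min: "\<And>Q. path_system H V Q \<Longrightarrow> m P \<le> m Q"
    using ex_has_least_nat[of "path_system H V" "(\<lambda>v. [v]) ` V" m] path_system_singletons[OF fin, of H]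
    by blast
  have fP: "finite P" and ne: "\<And>p. p \<in> P \<Longrightarrow> p \<noteq> []" and dp: "\<And>p. p \<in> P \<Longrightarrow> distinct p"
    and sp: "\<And>p. p \<in> P \<Longrightarrow> successively H p"
    and dj: "\<And>p q. p \<in> P \<Longrightarrow> q \<in> P \<Longrightarrow> p \<noteq> q \<Longrightarrow> set p \<inter> set q = {}"
    and cov: "(\<Union>p\<in>P. set p) = V"
    using P by (auto simp: path_system_def)
  have card2: "card (P - {p,q}) + 2 = card P" if "p \<in> P" "q \<in> P" "p \<noteq> q" for p q
  proof -
    have "card {p,q} \<le> card P" using that fP by (intro card_mono) auto
    then show ?thesis using that fP by (simp add: card_Diff_subset)
  qed
  have merge: "False" if "p \<in> P" "q \<in> P" "p \<noteq> q" and r: "r \<noteq> []" "distinct r" "successively H r"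
    "set r = set p \<union> set q" for p q r
  proof -
    have "path_system H V (insert r (({[]} - {[]}) \<union> (P - {p,q})))"
      using that by (intro path_system_replace2[OF P]) auto
    then have Q: "path_system H V (insert r (P - {p,q}))" by simp
    have "card (insert r (P - {p,q})) \<le> Suc (card (P - {p,q}))" by (rule card_insert_le_m1) auto
    then have 1: "card (insert r (P - {p,q})) < card P" using card2[OF that(1-3)] by simp
    have "length r \<noteq> 1"
    proof -
      have "card (set r) = card (set p) + card (set q)"
        using dj[OF that(1-3)] r(4) by (simp add: card_Un_disjoint)
      moreover have "card (set p) > 0" "card (set q) > 0" using ne that by (auto simp: card_gt_0_iff)
      ultimately show ?thesis using r(2) distinct_card by fastforce
    qed
    then have "singleton_paths (insert r (P - {p,q})) \<subseteq> singleton_paths P"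
      by (auto simp: singleton_paths_def)
    then have "card (singleton_paths (insert r (P - {p,q}))) \<le> card (singleton_paths P)"
      using fP by (intro card_mono) (auto simp: singleton_paths_def)
    then show False using 1 min[OF Q] by (simp add: m_def)
  qed
  have joinable: False if "p \<in> P" "q \<in> P" "p \<noteq> q" "H (last p) (hd q)" for p q
  proof (rule merge[of p q "p @ q"])
    show "successively H (p @ q)" using that sp by (simp add: successively_append_iff)
    show "distinct (p @ q)" using dp dj that by auto
  qed (use that ne in auto)
  have ends: False if "p \<in> P" "q \<in> P" "p \<noteq> q" "H (last p) (last q)" for p q
  proof (rule merge[of p q "p @ rev q"])
    show "successively H (p @ rev q)"
      using that sp ne successively_rev_sym[OF sym sp]
      by (auto simp: successively_append_iff hd_rev)
    show "distinct (p @ rev q)" using dp dj that by auto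
  qed (use that ne in auto)
  have cardP: "card P < K"
  proof (rule ccontr)
    assume "\<not> card P < K"
    moreover have inj: "inj_on last P"
      using dj ne by (intro inj_onI) (metis disjoint_iff last_in_set)
    ultimately have "K \<le> card (last ` P)" by (simp add: card_image)
    then obtain A where A: "A \<subseteq> last ` P" "card A = K"
      by (rule obtain_subset_with_card_n) blast
    have "last ` P \<subseteq> V" using cov ne by auto
    then have "A \<subseteq> V" using A by blast
    then obtain x y where "x \<in> A" "y \<in> A" "H x y" using indep A by blast
    then obtain p q where pq: "p \<in> P" "q \<in> P" "H (last p) (last q)" using A by blast
    then have "p \<noteq> q" using irr by auto
    then show False using ends pq by blast
  qed
  have "2 \<le> length p" if "p \<in> P" for p
  proof (rule ccontr)
    assume "\<not> 2 \<le> length p"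
    moreover have "length p > 0" using ne[OF that] by simp
    ultimately have "length p = 1" by linarith
    then obtain z where z: "p = [z]" by (auto simp: length_Suc_conv)
    have zV: "z \<in> V" using cov that z by auto
    define mid where "mid q = q ! 1" for q :: "'a list"
    have "{u. H z u} \<subseteq> mid ` P"
    proof
      fix u assume "u \<in> {u. H z u}"
      then have zu: "H z u" by simp
      then obtain q where q: "q \<in> P" "u \<in> set q" using HV cov by blast
      have pq: "p \<noteq> q" using q zu z irr by auto
      obtain q1 q2 where q12: "q = q1 @ u # q2" using q(2) by (meson split_list)
      \<comment> \<open>If \<open>u\<close> were the first vertex of \<open>q\<close>, then
        \<open>[z]\<close> could be joined in front of \<open>q\<close>.\<close>
      have q1: "q1 \<noteq> []"
        using joinable[OF that q(1) pq] zu z q12 by (cases q1) auto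
      have znq: "z \<notin> set q" using dj[OF that q(1) pq] z by auto
      have long: "length q1 = 1"
      proof (rule ccontr)
        assume l: "length q1 \<noteq> 1"
        \<comment> \<open>Cutting \<open>q\<close> before \<open>u\<close> and putting
          \<open>z\<close> in front of the second piece keeps the number of paths; \<open>q1\<close>
          has at least two vertices, so one singleton disappears and none arises.\<close>
        define r where "r = z # u # q2"
        have dq: "distinct q" and sq: "successively H q" using dp sp q by auto
        have r: "r \<noteq> []" "distinct r" "successively H r" "set r \<inter> set q1 = {}"
          using dq znq q12 sq zu by (auto simp: r_def successively_append_iff successively_Cons)
        have q1': "distinct q1 \<and> successively H q1"
          using dq sq q12 by (auto simp: successively_append_iff)
        have "path_system H V (insert r (({q1} - {[]}) \<union> (P - {p,q})))"
          using r q1' q12 z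
          by (intro path_system_replace2[OF P that q(1) pq]) (auto simp: r_def)
        then have Q: "path_system H V (insert r (insert q1 (P - {p,q})))" using q1 by (simp add: insert_absorb)
        have "card (insert r (insert q1 (P - {p,q}))) \<le> card (P - {p,q}) + 2"
          using fP by (simp add: card_insert_if)
        then have 1: "card (insert r (insert q1 (P - {p,q}))) \<le> card P"
          using card2[OF that q(1) pq] by simp
        have "singleton_paths (insert r (insert q1 (P - {p,q}))) \<subseteq> singleton_paths P - {p}"
          using l by (auto simp: singleton_paths_def r_def)
        then have "card (singleton_paths (insert r (insert q1 (P - {p,q})))) \<le> card (singleton_paths P - {p})"
          using fP by (intro card_mono) (auto simp: singleton_paths_def)
        also have "\<dots> < card (singleton_paths P)"
          using fP that z by (intro card_Diff1_less) (auto simp: singleton_paths_def)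
        finally show False using 1 min[OF Q] by (simp add: m_def)
      qed
      then have "mid q = u" using q12 by (simp add: mid_def nth_append)
      then show "u \<in> mid ` P" using q by blast
    qed
    then have "card {u. H z u} \<le> card P"
      using fP by (meson card_image_le card_mono finite_imageI order_trans)
    then show False using deg[OF zV] cardP by simp
  qed
  then show ?thesis using P cardP by blast
qed

section \<open>Slots, bounded prefix sums and transfers along a path\<close>

text \<open>Greedy choice in increasing order of \<open>r\<close>: each index takes the first free
  integer from \<open>r i\<close> upwards. The strengthened induction records that all integers
  skipped on the way are occupied. The block of occupied integers reached from \<open>r i\<close>
  then holds only members of \<open>U\<close> and slots of indices whose \<open>r\<close> lies
  between the left end of the block and \<open>r i\<close>; the density hypothesis bounds its
  length.\<close>

lemma exists_slots:
  fixes r :: "'i \<Rightarrow> int" and D :: int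
  assumes "finite I" "finite U"
    and "\<And>a b. a \<le> b \<Longrightarrow> int (card {i\<in>I. a \<le> r i \<and> r i \<le> b}) \<le> b - a + D"
    and "0 \<le> D"
  shows "\<exists>T. inj_on T I \<and> T ` I \<inter> U = {} \<and> (\<forall>i\<in>I. r i \<le> T i \<and> T i \<le> r i + D + int (card U))"
proof -
  have "\<exists>T. inj_on T I \<and> T ` I \<inter> U = {} \<and> (\<forall>i\<in>I. r i \<le> T i \<and> T i \<le> r i + D + int (card U)) \<and>
          (\<forall>i\<in>I. {r i..<T i} \<subseteq> U \<union> T ` I)"
    using assms(1,3)
  proof (induction I rule: finite_ranking_induct[where f = r])
    case empty
    then show ?case by simp
  next
    case (insert i I)
    show ?case
    proof (cases "i \<in> I")
      case True
      then have "insert i I = I" by auto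
      then show ?thesis using insert by simp
    next
      case False
      have "int (card {i\<in>I. a \<le> r i \<and> r i \<le> b}) \<le> b - a + D" if "a \<le> b" for a b
      proof -
        have "card {i\<in>I. a \<le> r i \<and> r i \<le> b} \<le> card {j\<in>insert i I. a \<le> r j \<and> r j \<le> b}"
          using insert.hyps(1) by (intro card_mono) auto
        then show ?thesis using insert.prems[OF that] by linarith
      qed
      then obtain T where T: "inj_on T I" "T ` I \<inter> U = {}"
        "\<forall>i\<in>I. r i \<le> T i \<and> T i \<le> r i + D + int (card U)"
        "\<forall>i\<in>I. {r i..<T i} \<subseteq> U \<union> T ` I"
        using insert.IH by blast
      define X where "X = U \<union> T ` I"
      have fX: "finite X" using insert.hyps(1) assms(2) by (simp add: X_def)
      have "\<exists>k::nat. r i + int k \<notin> X"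
      proof (rule ccontr)
        assume "\<not> ?thesis"
        then have "range (\<lambda>k::nat. r i + int k) \<subseteq> X" by auto
        then have "finite (range (\<lambda>k::nat. r i + int k))" using fX finite_subset by blast
        then show False by (simp add: finite_image_iff inj_def)
      qed
      then obtain k where k: "r i + int k \<notin> X" "\<And>j. j < k \<Longrightarrow> r i + int j \<in> X"
        using exists_least_iff[of "\<lambda>k. r i + int k \<notin> X"] by blast
      define t where "t = r i + int k"
      have t: "t \<notin> X" "{r i..<t} \<subseteq> X" "r i \<le> t"
      proof -
        show "{r i..<t} \<subseteq> X"
        proof
          fix x assume "x \<in> {r i..<t}"
          then have "nat (x - r i) < k" "x = r i + int (nat (x - r i))" by (auto simp: t_def)
          then show "x \<in> X" using k(2) by metis
        qed
      qed (use k in \<open>auto simp: t_def\<close>)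
      have "\<exists>k::nat. r i - 1 - int k \<notin> X"
      proof (rule ccontr)
        assume "\<not> ?thesis"
        then have "range (\<lambda>k::nat. r i - 1 - int k) \<subseteq> X" by auto
        then have "finite (range (\<lambda>k::nat. r i - 1 - int k))" using fX finite_subset by blast
        then show False by (simp add: finite_image_iff inj_def)
      qed
      then obtain l where l: "r i - 1 - int l \<notin> X" "\<And>j. j < l \<Longrightarrow> r i - 1 - int j \<in> X"
        using exists_least_iff[of "\<lambda>k. r i - 1 - int k \<notin> X"] by blast
      \<comment> \<open>\<open>a\<close> is the left end of the maximal run of occupied integers
        ending just below \<open>t\<close>.\<close>
      define a where "a = r i - int l"
      have a: "a - 1 \<notin> X" "{a..<t} \<subseteq> X" "a \<le> r i"
      proof -
        show "{a..<t} \<subseteq> X"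
        proof
          fix x assume x: "x \<in> {a..<t}"
          show "x \<in> X"
          proof (cases "x \<ge> r i")
            case True
            then show ?thesis using t(2) x by auto
          next
            case False
            then have "nat (r i - 1 - x) < l" "x = r i - 1 - int (nat (r i - 1 - x))"
              using x by (auto simp: a_def)
            then show ?thesis using l(2) by metis
          qed
        qed
      qed (use l in \<open>auto simp: a_def algebra_simps\<close>)
      define J where "J = {j\<in>I. a \<le> r j \<and> r j \<le> r i}"
      have "{a..<t} \<subseteq> U \<union> T ` J"
      proof
        fix x assume x: "x \<in> {a..<t}"
        show "x \<in> U \<union> T ` J"
        proof (cases "x \<in> U")
          case False
          then obtain j where j: "j \<in> I" "x = T j" using a(2) x by (auto simp: X_def)
          \<comment> \<open>An index starting below \<open>a\<close> but placed at or beyond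
            \<open>a\<close> would have skipped \<open>a - 1\<close>, which is free.\<close>
          have "a \<le> r j"
          proof (rule ccontr)
            assume "\<not> a \<le> r j"
            then have "a - 1 \<in> {r j..<T j}" using x j by auto
            then show False using T(4) j(1) a(1) unfolding X_def by blast
          qed
          moreover have "r j \<le> r i" using insert.hyps(2) j(1) by blast
          ultimately show ?thesis using j by (auto simp: J_def)
        qed simp
      qed
      then have "card {a..<t} \<le> card (U \<union> T ` J)"
        using assms(2) insert.hyps(1) by (intro card_mono) (auto simp: J_def)
      also have "\<dots> \<le> card U + card (T ` J)" by (rule card_Un_le)
      also have "\<dots> \<le> card U + card J"
        using insert.hyps(1) by (intro add_left_mono card_image_le) (auto simp: J_def)
      finally have c1: "t - a \<le> int (card U) + int (card J)" using a(3) t(3) by simp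
      have "insert i J = {j\<in>insert i I. a \<le> r j \<and> r j \<le> r i}" using a(3) by (auto simp: J_def)
      moreover have "i \<notin> J" "finite J" using False insert.hyps(1) by (auto simp: J_def)
      ultimately have "int (card J) + 1 \<le> r i - a + D" using insert.prems[OF a(3)] 
        by (metis card_insert_disjoint of_nat_Suc add.commute)
      then have tb: "t \<le> r i + D + int (card U)" using c1 by linarith
      define T' where "T' = T(i := t)"
      have im: "T' ` insert i I = insert t (T ` I)" using False by (auto simp: T'_def)
      have "inj_on T' (insert i I)"
        using T(1) t(1) False by (auto simp: T'_def inj_on_def X_def)
      moreover have "T' ` insert i I \<inter> U = {}" unfolding im using T(2) t(1) by (auto simp: X_def)
      moreover have "\<forall>j\<in>insert i I. r j \<le> T' j \<and> T' j \<le> r j + D + int (card U)"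
        using T(3) t(3) tb by (auto simp: T'_def)
      moreover have "\<forall>j\<in>insert i I. {r j..<T' j} \<subseteq> U \<union> T' ` insert i I"
      proof
        fix j assume "j \<in> insert i I"
        then show "{r j..<T' j} \<subseteq> U \<union> T' ` insert i I"
          unfolding im using T(4) t(2) False by (cases "j = i") (auto simp: T'_def X_def)
      qed
      ultimately show ?thesis by blast
    qed
  qed
  then show ?thesis by blast
qed

text \<open>Choice 0 drifts by at most \<open>D\<close> per step, hence by at most \<open>W\<close>
  over \<open>k\<close> steps; at every \<open>k\<close>-th step a jump of about \<open>W\<close>
  against the sign of the running sum undoes this. The invariant is
  \<open>|S| <= W + D + (m mod k) * D\<close>.\<close>

lemma bounded_prefix_choice:
  fixes e :: "nat \<Rightarrow> nat \<Rightarrow> int" and D W :: int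
  assumes k: "0 < k" and D: "0 \<le> D" "int k * D \<le> W"
    and e0: "\<And>t. 0 \<le> e 0 t \<and> e 0 t \<le> D"
    and e1: "\<And>t. - W \<le> e 1 t \<and> e 1 t \<le> - W + D"
    and e2: "\<And>t. W \<le> e 2 t \<and> e 2 t \<le> W + D"
  shows "\<exists>c. (\<forall>t. c t \<in> (if Suc t mod k = 0 then {1,2} else {0})) \<and>
           (\<forall>m. \<bar>\<Sum>t<m. e (c t) t\<bar> \<le> 2 * W + D)"
proof -
  have W0: "0 \<le> W" using D by (meson mult_nonneg_nonneg of_nat_0_le_iff order_trans)
  define P where "P m S \<longleftrightarrow> \<bar>S\<bar> \<le> W + D + int (m mod k) * D" for m and S :: int
  define Q where "Q m S S' \<longleftrightarrow> (\<exists>c\<in>(if Suc m mod k = 0 then {1,2} else {0}). S' = S + e c m)" for m S S'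
  have "\<exists>S. S 0 = 0 \<and> (\<forall>m. P m (S m) \<and> Q m (S m) (S (Suc m)))"
  proof (rule dependent_nat_choice[of "\<lambda>m S. P m S \<and> (m = 0 \<longrightarrow> S = 0)" Q, THEN exE])
    show "\<exists>S. P 0 S \<and> (0 = 0 \<longrightarrow> S = 0)" using D W0 by (auto simp: P_def)
  next
    fix S m assume "P m S \<and> (m = 0 \<longrightarrow> S = 0)"
    then have S: "P m S" by simp
    show "\<exists>S'. (P (Suc m) S' \<and> (Suc m = 0 \<longrightarrow> S' = 0)) \<and> Q m S S'"
    proof (cases "Suc m mod k = 0")
      case True
      then have mk: "Suc (m mod k) = k" using k by (metis mod_Suc nat.distinct(1))
      have "int k = int (m mod k) + 1" using mk by linarith
      then have "int (m mod k) * D = int k * D - D" by (simp add: algebra_simps)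
      then have S': "\<bar>S\<bar> \<le> W + int k * D" using S by (simp add: P_def)
      define c :: nat where "c = (if S \<ge> 0 then 1 else 2)"
      have "\<bar>S + e c m\<bar> \<le> W + D"
        using S' e1[of m] e2[of m] D by (auto simp: c_def abs_le_iff)
      then show ?thesis using True by (intro exI[of _ "S + e c m"]) (auto simp: P_def Q_def c_def)
    next
      case False
      then have mk: "Suc m mod k = Suc (m mod k)" by (metis mod_Suc)
      have "\<bar>S + e 0 m\<bar> \<le> W + D + int (m mod k) * D + D" using S e0[of m] by (auto simp: P_def)
      also have "\<dots> = W + D + int (Suc m mod k) * D" unfolding mk by (simp add: algebra_simps)
      finally show ?thesis using False by (intro exI[of _ "S + e 0 m"]) (auto simp: P_def Q_def)
    qed
  next
    fix S assume "\<forall>m. (P m (S m) \<and> (m = 0 \<longrightarrow> S m = 0)) \<and> Q m (S m) (S (Suc m))"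
    then show "\<exists>S. S 0 = 0 \<and> (\<forall>m. P m (S m) \<and> Q m (S m) (S (Suc m)))" by blast
  qed
  then obtain S where S: "S 0 = 0" "\<And>m. P m (S m)" "\<And>m. Q m (S m) (S (Suc m))" by blast
  have "\<forall>m. \<exists>c. c \<in> (if Suc m mod k = 0 then {1,2} else {0}) \<and> S (Suc m) = S m + e c m"
    using S(3) unfolding Q_def by blast
  then obtain c where c: "\<And>m. c m \<in> (if Suc m mod k = 0 then {1,2} else {0})"
    "\<And>m. S (Suc m) = S m + e (c m) m" by metis
  have sum: "(\<Sum>t<m. e (c t) t) = S m" for m by (induction m) (use S(1) c(2) in auto)
  have "\<bar>S m\<bar> \<le> 2 * W + D" for m
  proof -
    have "int (m mod k) * D \<le> int k * D"
      using D k by (intro mult_right_mono) (auto simp: less_imp_le)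
    then show ?thesis using S(2)[of m] D by (simp add: P_def)
  qed
  then show ?thesis using c(1) by (intro exI[of _ c]) (auto simp: sum)
qed

text \<open>\<open>g v w\<close> is the change of the edge \<open>vw\<close> in favour of
  \<open>v\<close>. The first vertex obtains its displacement from the second through that many
  common middle vertices, and the rest of the path is treated with this debt added to the second
  vertex; thus the prefix sums are what passes along the path. The bound at the head counts the
  middle vertices it already uses, and \<open>2 * M\<close> common ones leave \<open>M\<close>
  fresh.\<close>

lemma path_transfer:
  fixes s :: "'a \<Rightarrow> int" and M :: nat
  assumes "finite V" "\<And>v. Mid v \<subseteq> V" "xs \<noteq> []" "distinct xs"
    and "successively (\<lambda>a b. 2 * M \<le> card (Mid a \<inter> Mid b)) xs"
    and "\<And>i. \<bar>\<Sum>v\<leftarrow>take i xs. s v\<bar> \<le> int M"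
    and "(\<Sum>v\<leftarrow>xs. s v) = 0"
  shows "\<exists>g. (\<forall>v w. g v w \<in> {-1, 0, 1::int}) \<and>
           (\<forall>v w. g v w \<noteq> 0 \<longrightarrow> v \<in> set xs \<and> w \<in> Mid v) \<and>
           (\<forall>w. (\<Sum>v\<in>set xs. g v w) = 0) \<and>
           (\<forall>v\<in>set xs. (\<Sum>w\<in>V. g v w) = s v) \<and>
           card {w. g (hd xs) w \<noteq> 0} \<le> M"
  using assms(3-7)
proof (induction xs arbitrary: s rule: induct_list012)
  case 1
  then show ?case by simp
next
  case (2 x)
  then show ?case by (intro exI[of _ "\<lambda>_ _. 0"]) auto
next
  case (3 x y zs)
  define s' where "s' = s(y := s x + s y)"
  have xy: "x \<notin> set (y # zs)" "y \<notin> set zs" "x \<noteq> y" using 3(4) by auto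
  have ms: "map s' zs' = map s zs'" if "set zs' \<subseteq> set zs" for zs'
    using that xy by (auto simp: s'_def)
  have pre: "\<bar>\<Sum>v\<leftarrow>take i (y # zs). s' v\<bar> \<le> int M" for i
  proof (cases i)
    case (Suc j)
    have "(\<Sum>v\<leftarrow>take i (y # zs). s' v) = s' y + (\<Sum>v\<leftarrow>take j zs. s v)"
      using Suc ms[of "take j zs"] set_take_subset by (metis sum_list.Cons take_Suc_Cons list.simps(9))
    also have "\<dots> = (\<Sum>v\<leftarrow>take (Suc (Suc j)) (x # y # zs). s v)" by (simp add: s'_def)
    finally show ?thesis using 3(6)[of "Suc (Suc j)"] by simp
  qed simp
  have tot: "(\<Sum>v\<leftarrow>y # zs. s' v) = 0" 
  proof -
    have "(\<Sum>v\<leftarrow>y # zs. s' v) = s' y + (\<Sum>v\<leftarrow>zs. s v)" using ms[of zs] by (metis list.simps(9) order_refl sum_list.Cons)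
    then show ?thesis using 3(7) by (simp add: s'_def)
  qed
  have "\<exists>g. (\<forall>v w. g v w \<in> {-1, 0, 1::int}) \<and>
           (\<forall>v w. g v w \<noteq> 0 \<longrightarrow> v \<in> set (y # zs) \<and> w \<in> Mid v) \<and>
           (\<forall>w. (\<Sum>v\<in>set (y # zs). g v w) = 0) \<and>
           (\<forall>v\<in>set (y # zs). (\<Sum>w\<in>V. g v w) = s' v) \<and>
           card {w. g (hd (y # zs)) w \<noteq> 0} \<le> M"
    by (rule 3(2)) (use 3(4,5) pre tot in auto)
  then obtain g where g: "\<And>v w. g v w \<in> {-1, 0, 1::int}"
    "\<And>v w. g v w \<noteq> 0 \<Longrightarrow> v \<in> set (y # zs) \<and> w \<in> Mid v"
    "\<And>w. (\<Sum>v\<in>set (y # zs). g v w) = 0"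
    "\<And>v. v \<in> set (y # zs) \<Longrightarrow> (\<Sum>w\<in>V. g v w) = s' v"
    "card {w. g y w \<noteq> 0} \<le> M" unfolding list.sel(1) by blast
  define Z where "Z = {w. g y w \<noteq> 0}"
  have fZ: "finite Z" using g(2) assms(1,2) by (metis (mono_tags, lifting) Z_def finite_subset mem_Collect_eq subsetI)
  have sx: "\<bar>s x\<bar> \<le> int M" using 3(6)[of 1] by simp
  have "2 * M \<le> card (Mid x \<inter> Mid y)" using 3(5) by simp
  moreover have "card (Mid x \<inter> Mid y) - card Z \<le> card (Mid x \<inter> Mid y - Z)"
    using fZ by (rule diff_card_le_card_Diff)
  ultimately have "nat \<bar>s x\<bar> \<le> card (Mid x \<inter> Mid y - Z)" using g(5) sx by (simp add: Z_def)
  then obtain W where W: "W \<subseteq> Mid x \<inter> Mid y - Z" "card W = nat \<bar>s x\<bar>"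
    by (meson obtain_subset_with_card_n)
  have WV: "W \<subseteq> V" using W(1) assms(2) by blast
  have fW: "finite W" using WV assms(1) finite_subset by blast
  \<comment> \<open>Each \<open>w\<close> in \<open>W\<close> moves one unit between
    \<open>x\<close> and \<open>y\<close>, and its own column sum stays 0.\<close>
  define d where "d v w = (if w \<in> W then sgn (s x) * (of_bool (v = x) - of_bool (v = y)) else 0)" for v w
  define g' where "g' v w = g v w + d v w" for v w
  have gx: "g x w = 0" for w using g(2) xy(1) by blast
  have gy: "g y w = 0" if "w \<in> W" for w using that W(1) by (auto simp: Z_def)
  have sum_if: "(\<Sum>w\<in>V. if w \<in> W then c else 0) = c * \<bar>s x\<bar>" for c :: int
  proof -
    have "(\<Sum>w\<in>V. if w \<in> W then c else 0) = (\<Sum>w\<in>W. c)"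
      using WV assms(1) by (simp add: sum.inter_restrict[symmetric] Int_absorb1)
    then show ?thesis using W(2) by simp
  qed
  have sg: "sgn (s x) * \<bar>s x\<bar> = s x" by (simp add: sgn_mult_abs)
  have 1: "g' v w \<in> {-1,0,1}" for v w
    using g(1)[of v w] gx[of w] gy[of w] xy(3)
    by (cases "s x" "0::int" rule: linorder_cases) (auto simp: g'_def d_def)
  have 2: "v \<in> set (x # y # zs) \<and> w \<in> Mid v" if nz: "g' v w \<noteq> 0" for v w
  proof (cases "g v w = 0")
    case True
    then have "d v w \<noteq> 0" using nz by (simp add: g'_def)
    then have "w \<in> W" "v = x \<or> v = y" by (auto simp: d_def split: if_splits)
    then show ?thesis using W(1) by auto
  next
    case False
    then show ?thesis using g(2) by auto
  qed
  have 3: "(\<Sum>v\<in>set (x # y # zs). g' v w) = 0" for w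
  proof -
    have "(\<Sum>v\<in>set (x # y # zs). g' v w) = g' x w + (\<Sum>v\<in>set (y # zs). g' v w)"
      using xy(1) by simp
    also have "(\<Sum>v\<in>set (y # zs). g' v w) = (\<Sum>v\<in>set (y # zs). g v w) + (\<Sum>v\<in>set (y # zs). d v w)"
      by (simp add: g'_def sum.distrib)
    also have "(\<Sum>v\<in>set (y # zs). d v w) = d y w + (\<Sum>v\<in>set zs. d v w)" using xy by simp
    also have "(\<Sum>v\<in>set zs. d v w) = 0" using xy by (intro sum.neutral) (auto simp: d_def)
    finally show ?thesis using g(3) gx xy(3) by (simp add: g'_def d_def)
  qed
  have 4: "(\<Sum>w\<in>V. g' v w) = s v" if v: "v \<in> set (x # y # zs)" for v
  proof -
    have "(\<Sum>w\<in>V. g' v w) = (\<Sum>w\<in>V. g v w) + (sgn (s x) * (of_bool (v = x) - of_bool (v = y))) * \<bar>s x\<bar>"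
      unfolding g'_def d_def sum.distrib sum_if ..
    also have "\<dots> = (\<Sum>w\<in>V. g v w) + s x * (of_bool (v = x) - of_bool (v = y))"
      using sg by (simp add: algebra_simps)
    also have "\<dots> = s v"
    proof (cases "v = x")
      case True
      then show ?thesis using gx xy by simp
    next
      case False
      then have "v \<in> set (y # zs)" using v by simp
      then show ?thesis using g(4)[of v] False by (auto simp: s'_def)
    qed
    finally show ?thesis .
  qed
  have 5: "card {w. g' (hd (x # y # zs)) w \<noteq> 0} \<le> M"
  proof -
    have "{w. g' x w \<noteq> 0} \<subseteq> W" using gx by (auto simp: g'_def d_def)
    then have "card {w. g' x w \<noteq> 0} \<le> card W" using fW card_mono by blast
    then show ?thesis using W(2) sx by simp
  qed
  show ?case using 1 2 3 4 5 by (intro exI[of _ g']) blast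
qed

text \<open>The sum of the two values of \<open>p\<close> is the same for every \<open>i p\<close>.
  At most \<open>2 * (K - 1)\<close> earlier values each exclude at most one \<open>i\<close> for
  either new value, and at most one further \<open>i\<close> makes the two coincide: no more than
  \<open>4 * K - 3\<close> of the \<open>4 * K\<close> candidates are lost.\<close>

lemma distinct_pair_choice:
  fixes a b l :: "'p \<Rightarrow> int" and B :: int
  assumes "finite P" "card P \<le> K" "0 < B"
  shows "\<exists>i. (\<forall>p\<in>P. l p \<le> i p \<and> i p < l p + 4 * int K) \<and>
           inj_on (\<lambda>(p, y). if y then a p + i p * B else b p - i p * B) (P \<times> UNIV)"
  using assms(1,2)
proof (induction P rule: finite_induct)
  case empty
  then show ?case by simp
next
  case (insert p P)
  define val where "val i = (\<lambda>(p, y). if y then a p + i p * B else b p - i p * B)" for i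
  obtain i where i: "\<forall>p\<in>P. l p \<le> i p \<and> i p < l p + 4 * int K" "inj_on (val i) (P \<times> UNIV)"
    using insert unfolding val_def by auto
  define X where "X = val i ` (P \<times> UNIV)"
  have fX: "finite X" using insert by (simp add: X_def)
  have "card X \<le> card (P \<times> (UNIV :: bool set))" unfolding X_def using insert by (intro card_image_le) simp
  then have cX: "card X \<le> 2 * card P" by (simp add: card_cartesian_product)
  define F1 where "F1 = {j. a p + j * B \<in> X}"
  define F2 where "F2 = {j. b p - j * B \<in> X}"
  define F3 where "F3 = {j. a p + j * B = b p - j * B}"
  have 1: "finite F1 \<and> card F1 \<le> card X"
  proof -
    have "inj_on (\<lambda>j. a p + j * B) F1" using assms(3) by (auto simp: inj_on_def)
    moreover have "(\<lambda>j. a p + j * B) ` F1 \<subseteq> X" by (auto simp: F1_def)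
    ultimately show ?thesis using fX by (meson card_inj_on_le inj_on_finite)
  qed
  have 2: "finite F2 \<and> card F2 \<le> card X"
  proof -
    have "inj_on (\<lambda>j. b p - j * B) F2" using assms(3) by (auto simp: inj_on_def)
    moreover have "(\<lambda>j. b p - j * B) ` F2 \<subseteq> X" by (auto simp: F2_def)
    ultimately show ?thesis using fX by (meson card_inj_on_le inj_on_finite)
  qed
  have 3: "finite F3 \<and> card F3 \<le> 1"
  proof -
    have "x = y" if "x \<in> F3" "y \<in> F3" for x y
    proof -
      have "a p + x * B = b p - x * B" "a p + y * B = b p - y * B" using that unfolding F3_def by blast+
      then have "x * B = y * B" by linarith
      then show ?thesis using assms(3) by simp
    qed
    then have "F3 = {} \<or> (\<exists>x. F3 = {x})" by blast
    then show ?thesis by auto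
  qed
  have "card (F1 \<union> F2 \<union> F3) \<le> card F1 + card F2 + card F3"
    by (meson add_le_mono card_Un_le le_refl order_trans)
  also have "\<dots> < card {l p..<l p + 4 * int K}"
  proof -
    have "Suc (card P) \<le> K" using insert by simp
    then have "card F1 + card F2 + card F3 < 4 * K" using 1 2 3 cX by linarith
    then show ?thesis by simp
  qed
  finally have "\<not> {l p..<l p + 4 * int K} \<subseteq> F1 \<union> F2 \<union> F3"
    using 1 2 3 by (metis card_mono finite_UnI leD)
  then obtain j where "j \<in> {l p..<l p + 4 * int K}" "j \<notin> F1 \<union> F2 \<union> F3" by blast
  then have j: "l p \<le> j" "j < l p + 4 * int K" "j \<notin> F1" "j \<notin> F2" "j \<notin> F3" by auto
  define i' where "i' = i(p := j)"
  have old: "val i' x = val i x" if "x \<in> P \<times> UNIV" for x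
    using that insert(2) by (auto simp: val_def i'_def)
  have new: "val i' (p, True) = a p + j * B" "val i' (p, False) = b p - j * B"
    by (auto simp: val_def i'_def)
  have ins: "inj_on f (insert x A)" if "inj_on f A" "f x \<notin> f ` A" for f :: "'p \<times> bool \<Rightarrow> int" and x A
    using that by (simp add: inj_on_insert) blast
  have "inj_on (val i') (P \<times> UNIV) \<longleftrightarrow> inj_on (val i) (P \<times> UNIV)" using old by (intro inj_on_cong) simp
  then have inj: "inj_on (val i') (P \<times> UNIV)" using i(2) by simp
  have im: "val i' ` (P \<times> UNIV) = X" unfolding X_def using old by (intro image_cong) simp_all
  have eq: "insert p P \<times> (UNIV :: bool set) = insert (p, True) (insert (p, False) (P \<times> UNIV))"
    by (auto simp: UNIV_bool)
  have "val i' (p, False) \<notin> X" "val i' (p, True) \<notin> insert (val i' (p, False)) X"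
    using j(3-5) unfolding new F1_def F2_def F3_def by blast+
  then have inj': "inj_on (val i') (insert p P \<times> UNIV)"
    unfolding eq by (intro ins inj) (simp_all only: image_insert im not_False_eq_True)
  have "\<forall>u\<in>insert p P. l u \<le> i' u \<and> i' u < l u + 4 * int K" using i(1) j by (auto simp: i'_def)
  then show ?case using inj' unfolding val_def by blast
qed

lemma card_le_diameter:
  fixes J :: "nat set" and r :: real
  assumes "finite J" "0 \<le> r" "\<And>i j. i \<in> J \<Longrightarrow> j \<in> J \<Longrightarrow> real i - real j \<le> r"
  shows "real (card J) \<le> r + 1"
proof (cases "J = {}")
  case False
  have "J \<subseteq> {Min J..Max J}" using assms(1) by auto
  then have "card J \<le> card {Min J..Max J}" by (intro card_mono) auto
  then have "real (card J) \<le> real (Max J) - real (Min J) + 1"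
    using Min_le[OF assms(1) Max_in[OF assms(1) False]] by simp
  then show ?thesis using assms(3)[of "Max J" "Min J"] assms(1) False by simp
qed (use assms in simp)

section \<open>Flexible edges and spread weighted degrees\<close>

text \<open>The residues {1, 2, 4} modulo 7 form a perfect difference set, so the orientation of the
  first component is a tournament in which any two (possibly equal) vertices dominate a common one.
  Two labels with grid coordinates (i, j) and (i', j') both meet the grid point (i, j').\<close>

definition label_arc :: "int \<times> nat \<times> nat \<Rightarrow> int \<times> nat \<times> nat \<Rightarrow> bool" where
  "label_arc = (\<lambda>(r, i, j) (r', i', j'). (r' - r) mod 7 \<in> {1, 2, 4} \<and> (i = i' \<or> j = j'))"

definition label_set :: "nat \<Rightarrow> (int \<times> nat \<times> nat) set" where
  "label_set q = {0..<7} \<times> {..<q} \<times> {..<q}"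

lemma finite_label_set: "finite (label_set q)"
  by (simp add: label_set_def)

lemma card_label_set: "card (label_set q) = 7 * q\<^sup>2"
  by (simp add: label_set_def card_cartesian_product power2_eq_square)

lemma label_arc_asym: "label_arc x y \<Longrightarrow> \<not> label_arc y x"
proof -
  assume xy: "label_arc x y"
  have *: "(c - d) mod 7 \<notin> {1, 2, 4}" if "(d - c) mod 7 \<in> {1, 2, 4}" for c d :: int
    using that by auto presburger+
  obtain r i j r' i' j' where "x = (r, i, j)" "y = (r', i', j')" by (metis prod_cases3)
  then show "\<not> label_arc y x" using xy *[where d = r' and c = r] unfolding label_arc_def by simp
qed

text \<open>Only \<open>d - c\<close> modulo 7 matters, and each of its seven values is a difference
  of two elements of {1, 2, 4}.\<close>

lemma tournament7_common:
  fixes c d :: int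
  shows "\<exists>e\<in>{0..<7}. (e - c) mod 7 \<in> {1, 2, 4} \<and> (e - d) mod 7 \<in> {1, 2, 4}"
proof -
  have "\<exists>k. k mod 7 \<in> {1, 2, 4} \<and> (k - (d - c)) mod 7 \<in> {1, 2, 4::int}"
  proof -
    have "(d - c) mod 7 \<in> {0, 1, 2, 3, 4, 5, 6}" by auto
    then consider "(d - c) mod 7 = 0" | "(d - c) mod 7 = 1" | "(d - c) mod 7 = 2"
      | "(d - c) mod 7 = 3" | "(d - c) mod 7 = 4" | "(d - c) mod 7 = 5" | "(d - c) mod 7 = 6"
      by auto
    then show ?thesis
    proof cases
      case 1 then show ?thesis by (intro exI[of _ 1]) (auto simp: mod_diff_right_eq[of 1 "d - c", symmetric])
    next
      case 2 then show ?thesis by (intro exI[of _ 2]) (auto simp: mod_diff_right_eq[of 2 "d - c", symmetric])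
    next
      case 3 then show ?thesis by (intro exI[of _ 4]) (auto simp: mod_diff_right_eq[of 4 "d - c", symmetric])
    next
      case 4 then show ?thesis by (intro exI[of _ 4]) (auto simp: mod_diff_right_eq[of 4 "d - c", symmetric])
    next
      case 5 then show ?thesis by (intro exI[of _ 1]) (auto simp: mod_diff_right_eq[of 1 "d - c", symmetric])
    next
      case 6 then show ?thesis by (intro exI[of _ 2]) (auto simp: mod_diff_right_eq[of 2 "d - c", symmetric])
    next
      case 7 then show ?thesis by (intro exI[of _ 1]) (auto simp: mod_diff_right_eq[of 1 "d - c", symmetric])
    qed
  qed
  then obtain k where k: "k mod 7 \<in> {1, 2, 4}" "(k - (d - c)) mod 7 \<in> {1, 2, 4::int}" by blast
  have "((c + k) mod 7 - c) mod 7 = k mod 7" by (simp add: mod_simps)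
  moreover have "((c + k) mod 7 - d) mod 7 = (k - (d - c)) mod 7" by (simp add: mod_simps algebra_simps)
  ultimately show ?thesis using k by (intro bexI[of _ "(c + k) mod 7"]) auto
qed

lemma label_arc_common:
  assumes "x \<in> label_set q" "y \<in> label_set q"
  shows "\<exists>z\<in>label_set q. label_arc x z \<and> label_arc y z"
proof -
  obtain r i j r' i' j' where xy: "x = (r, i, j)" "y = (r', i', j')" by (metis prod_cases3)
  obtain e where e: "e \<in> {0..<7}" "(e - r) mod 7 \<in> {1, 2, 4}" "(e - r') mod 7 \<in> {1, 2, 4}"
    using tournament7_common by blast
  show ?thesis
    using e assms xy by (intro bexI[of _ "(e, i, j')"]) (auto simp: label_arc_def label_set_def)
qed

text \<open>Labels joined by an arc lie in a common row or column of the grid. They form a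
  proportion of at most \<open>2 / q\<close> of the label set, which bounds the expected proportion
  of edges set aside.\<close>

lemma card_label_arcs:
  "card {y \<in> label_set q. label_arc x y \<or> label_arc y x} \<le> 14 * q"
proof -
  obtain r i j where x: "x = (r, i, j)" by (metis prod_cases3)
  have "{y \<in> label_set q. label_arc x y \<or> label_arc y x} \<subseteq>
      {0..<7} \<times> {i} \<times> {..<q} \<union> {0..<7} \<times> {..<q} \<times> {j}"
    by (auto simp: x label_arc_def label_set_def)
  then have "card {y \<in> label_set q. label_arc x y \<or> label_arc y x} \<le>
      card ({0..<7::int} \<times> {i} \<times> {..<q} \<union> {0..<7::int} \<times> {..<q} \<times> {j})"
    by (intro card_mono) auto
  also have "\<dots> \<le> card ({0..<7::int} \<times> {i} \<times> {..<q}) + card ({0..<7::int} \<times> {..<q} \<times> {j})"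
    by (rule card_Un_le)
  also have "\<dots> = 14 * q" by (simp add: card_cartesian_product)
  finally show ?thesis .
qed

section \<open>Labellings that concentrate: indicator tests and their averages\<close>

lemma sum_of_bool_conj:
  assumes "finite V"
  shows "(\<Sum>w\<in>V. of_bool (w \<in> A \<and> P w)) = real (card {w \<in> V \<inter> A. P w})"
proof -
  have "(\<Sum>w\<in>V. of_bool (w \<in> A \<and> P w)) = real (card {w \<in> V. w \<in> A \<and> P w})"
    using assms by (simp add: Int_def)
  also have "{w \<in> V. w \<in> A \<and> P w} = {w \<in> V \<inter> A. P w}" by auto
  finally show ?thesis .
qed

lemma average_of_bool_conj:
  assumes "finite V" "finite X" "A \<subseteq> V"
  shows "(\<Sum>w\<in>V. (\<Sum>x\<in>X. of_bool (w \<in> A \<and> x \<in> B)) / real m) = real (card A) * real (card (X \<inter> B)) / real m"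
proof -
  have inner: "(\<Sum>x\<in>X. of_bool (w \<in> A \<and> x \<in> B)) = (if w \<in> A then real (card (X \<inter> B)) else 0)" for w
    using assms(2) by (auto simp: Int_def)
  have "(\<Sum>w\<in>V. (if w \<in> A then real (card (X \<inter> B)) else 0) / real m) =
     (\<Sum>w\<in>V. if w \<in> A then real (card (X \<inter> B)) / real m else 0)"
    by (intro sum.cong) auto
  also have "\<dots> = (\<Sum>w\<in>V \<inter> A. real (card (X \<inter> B)) / real m)"
    by (rule sum.inter_restrict[OF assms(1), symmetric])
  also have "V \<inter> A = A" using assms(3) by auto
  finally show ?thesis unfolding inner by simp
qed

text \<open>Vertices receive labels, and an edge \<open>vw\<close> is flexible when the labels of
  its ends are joined by an arc. \<open>F v w\<close> lets \<open>w\<close> serve \<open>v\<close>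
  as a middle vertex; an arc has one direction, so no edge is claimed by both ends. Any two labels
  have a common out-neighbour \<open>l\<close>, and the common neighbours of \<open>u\<close> and
  \<open>v\<close> labelled \<open>l\<close>, about one in \<open>7 * q^2\<close>, are middle
  vertices for both.\<close>

lemma exists_flexible_orientation:
  fixes V :: "'a set" and N :: "'a \<Rightarrow> 'a set" and L t :: real
  assumes "finite V" "V \<noteq> {}" "\<And>v. N v \<subseteq> V" "0 < q"
    and L: "28 * real (card V)^2 * real q^2 \<le> exp L" "0 < L" "L \<le> card V"
  defines "t \<equiv> 2 * sqrt (real (card V) * L)"
  shows "\<exists>F. (\<forall>v w. F v w \<longrightarrow> \<not> F w v) \<and>
           (\<forall>v\<in>V. real (card {w \<in> N v. F v w \<or> F w v}) \<le> 2 * real (card V) / q + t) \<and>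
           (\<forall>u\<in>V. \<forall>v\<in>V. real (card (N u \<inter> N v)) / (7 * real q^2) - t
                \<le> real (card {w \<in> N u \<inter> N v. F u w \<and> F v w}))"
proof -
  define X where "X = label_set q"
  define Fl where "Fl l = {y. label_arc l y \<or> label_arc y l}" for l
  \<comment> \<open>Every label \<open>l\<close> is tested at \<open>v\<close>, because the label of
    \<open>v\<close> comes from the same function \<open>f\<close>; the case used is
    \<open>l = f v\<close>. Likewise \<open>h2\<close> runs over all labels and is applied to one
    dominated by both \<open>f u\<close> and \<open>f v\<close>.\<close>
  define h1 where "h1 = (\<lambda>(v, l) w x. of_bool (w \<in> N v \<and> x \<in> Fl l) :: real)"
  define h2 where "h2 = (\<lambda>(u, v, l :: int \<times> nat \<times> nat) w x. of_bool (w \<in> N u \<inter> N v \<and> x \<in> {l}) :: real)"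
  define H where "H = h1 ` (V \<times> X) \<union> h2 ` (V \<times> V \<times> X)"
  have fX: "finite X" "X \<noteq> {}" "card X = 7 * q^2"
    using finite_label_set card_label_set[of q] assms(4) by (auto simp: X_def)
  have n1: "real (card V) \<ge> 1" using assms(1,2) by (simp add: Suc_leI card_gt_0_iff)
  have fH: "finite H" using assms(1) fX by (simp add: H_def)
  have "card H \<le> card (h1 ` (V \<times> X)) + card (h2 ` (V \<times> V \<times> X))" unfolding H_def by (rule card_Un_le)
  also have "\<dots> \<le> card (V \<times> X) + card (V \<times> V \<times> X)"
    using assms(1) fX by (intro add_mono card_image_le) auto
  also have "\<dots> = card V * (7 * q^2) + card V * (card V * (7 * q^2))"
    by (simp add: card_cartesian_product fX)
  finally have "real (card H) \<le> real (card V * (7 * q^2) + card V * (card V * (7 * q^2)))" by linarith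
  also have "\<dots> \<le> real (card V)^2 * (7 * real q^2) + real (card V)^2 * (7 * real q^2)"
  proof -
    have "real (card V) * (7 * real q^2) \<le> real (card V)^2 * (7 * real q^2)"
      using n1 by (intro mult_right_mono) (auto simp: power2_eq_square)
    then show ?thesis by (simp add: power2_eq_square)
  qed
  finally have cH: "2 * real (card H) \<le> exp L" using L(1) by (simp add: mult.commute mult.left_commute)
  have "\<exists>f. (\<forall>v\<in>V. f v \<in> X) \<and>
           (\<forall>h\<in>H. \<bar>(\<Sum>v\<in>V. h v (f v)) - (\<Sum>v\<in>V. (\<Sum>x\<in>X. h v x) / card X)\<bar> \<le> 2 * sqrt (card V * L))"
  proof (rule exists_balanced_function)
    show "0 \<le> h v x \<and> h v x \<le> 1" if "h \<in> H" for h v x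
      using that by (auto simp: H_def h1_def h2_def)
  qed (use assms fX fH cH in auto)
  then obtain f where f: "\<And>v. v \<in> V \<Longrightarrow> f v \<in> X"
    "\<And>h. h \<in> H \<Longrightarrow> \<bar>(\<Sum>v\<in>V. h v (f v)) - (\<Sum>v\<in>V. (\<Sum>x\<in>X. h v x) / card X)\<bar> \<le> t"
    unfolding t_def by blast
  define F where "F v w = label_arc (f v) (f w)" for v w
  have 1: "\<not> F w v" if "F v w" for v w using that label_arc_asym by (auto simp: F_def)
  have 2: "real (card {w \<in> N v. F v w \<or> F w v}) \<le> 2 * real (card V) / q + t" if "v \<in> V" for v
  proof -
    have "h1 (v, f v) \<in> H" using that f(1) by (auto simp: H_def)
    from f(2)[OF this] have "(\<Sum>w\<in>V. h1 (v, f v) w (f w)) \<le> (\<Sum>w\<in>V. (\<Sum>x\<in>X. h1 (v, f v) w x) / card X) + t"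
      by linarith
    moreover have "(\<Sum>w\<in>V. h1 (v, f v) w (f w)) = real (card {w \<in> V \<inter> N v. f w \<in> Fl (f v)})"
      unfolding h1_def prod.case by (rule sum_of_bool_conj[OF assms(1)])
    moreover have "{w \<in> V \<inter> N v. f w \<in> Fl (f v)} = {w \<in> N v. F v w \<or> F w v}"
      using assms(3) by (auto simp: Fl_def F_def)
    moreover have "(\<Sum>w\<in>V. (\<Sum>x\<in>X. h1 (v, f v) w x) / card X) =
        real (card (N v)) * real (card (X \<inter> Fl (f v))) / real (card X)"
      unfolding h1_def prod.case by (rule average_of_bool_conj[OF assms(1) fX(1) assms(3)])
    moreover have "\<dots> \<le> 2 * real (card V) / q"
    proof -
      have "card (X \<inter> Fl (f v)) \<le> 14 * q"
        using card_label_arcs[of q "f v"] by (simp add: X_def Fl_def Int_def)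
      then have "real (card (X \<inter> Fl (f v))) \<le> 14 * real q" by linarith
      moreover have "real (card (N v)) \<le> real (card V)" using assms(1) assms(3)[of v] by (simp add: card_mono)
      ultimately have "real (card (N v)) * real (card (X \<inter> Fl (f v))) \<le> real (card V) * (14 * real q)"
        by (intro mult_mono) auto
      then have "real (card (N v)) * real (card (X \<inter> Fl (f v))) / real (card X) \<le>
          real (card V) * (14 * real q) / real (card X)" by (rule divide_right_mono) simp
      also have "\<dots> = 2 * real (card V) / q" using assms(4) by (simp add: fX power2_eq_square)
      finally show ?thesis .
    qed
    ultimately show ?thesis by simp
  qed
  have 3: "real (card (N u \<inter> N v)) / (7 * real q^2) - t \<le> real (card {w \<in> N u \<inter> N v. F u w \<and> F v w})"
    if uv: "u \<in> V" "v \<in> V" for u v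
  proof -
    obtain l where l: "l \<in> X" "label_arc (f u) l" "label_arc (f v) l"
      using label_arc_common[of "f u" q "f v"] f(1)[OF uv(1)] f(1)[OF uv(2)] unfolding X_def by blast
    have "h2 (u, v, l) \<in> H" using uv l by (auto simp: H_def)
    from f(2)[OF this] have "(\<Sum>w\<in>V. (\<Sum>x\<in>X. h2 (u, v, l) w x) / card X) - t \<le> (\<Sum>w\<in>V. h2 (u, v, l) w (f w))"
      by linarith
    moreover have "(\<Sum>w\<in>V. h2 (u, v, l) w (f w)) = real (card {w \<in> V \<inter> (N u \<inter> N v). f w \<in> {l}})"
      unfolding h2_def prod.case by (rule sum_of_bool_conj[OF assms(1)])
    moreover have "card {w \<in> V \<inter> (N u \<inter> N v). f w \<in> {l}} \<le> card {w \<in> N u \<inter> N v. F u w \<and> F v w}"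
      using l assms(1) finite_subset[OF assms(3)[of u] assms(1)] by (intro card_mono) (auto simp: F_def)
    moreover have "(\<Sum>w\<in>V. (\<Sum>x\<in>X. h2 (u, v, l) w x) / card X) =
        real (card (N u \<inter> N v)) * real (card (X \<inter> {l})) / real (card X)"
      unfolding h2_def prod.case using assms(3) by (intro average_of_bool_conj assms(1) fX(1)) auto
    moreover have "X \<inter> {l} = {l}" using l by auto
    ultimately show ?thesis by (simp add: fX)
  qed
  show ?thesis using 1 2 3 by (intro exI[of _ F]) blast
qed

text \<open>The labels are a grid version of uniform reals in the unit interval. Given
  \<open>x v = j\<close>, about a proportion \<open>(j + 1) / n\<close> of the neighbours passes the
  threshold, so the value of \<open>v\<close> is close to \<open>mu v j\<close>. This is linear in
  \<open>j\<close> with slope at least \<open>1 + e\<close>, hence few \<open>j\<close> put it into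
  a given interval, and the values on \<open>A\<close> have density at most
  \<open>card A / (n * (1 + e))\<close> up to the error terms. \<open>R\<close> is tested too
  because its vertices will own extra slots.\<close>

lemma exists_spread_values:
  fixes V R :: "'a set" and N :: "'a \<Rightarrow> 'a set" and c :: "'a \<Rightarrow> int" and L e t :: real and k B :: nat
  assumes "finite V" "V \<noteq> {}" "R \<subseteq> V" "\<And>v. N v \<subseteq> V" "0 \<le> e" "0 < k"
    and deg: "\<And>v. v \<in> V \<Longrightarrow> (1 + e) * card V \<le> real k * card (N v)"
    and c: "\<And>v. v \<in> V \<Longrightarrow> 0 \<le> c v \<and> c v + int k * int (card (N v)) \<le> int B"
    and L: "2 * (real (card V)^2 + 2 * (real B + 1)^2) \<le> exp L" "0 < L" "L \<le> card V"
  defines "t \<equiv> 2 * sqrt (real (card V) * L)"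
  shows "\<exists>x :: 'a \<Rightarrow> nat. \<forall>A\<in>{V, R}. \<forall>a b. a \<le> b \<longrightarrow>
     real (card {v \<in> A. a \<le> c v + int k * int (card {u \<in> N v. card V \<le> x u + x v + 1}) \<and>
                       c v + int k * int (card {u \<in> N v. card V \<le> x u + x v + 1}) \<le> b})
       \<le> card A / card V * (b - a) / (1 + e) + 2 * k * t + t + 1"
proof -
  define n where "n = card V"
  have n: "n > 0" using assms(1,2) by (simp add: n_def card_gt_0_iff)
  have t0: "t \<ge> 0" using L by (simp add: t_def)
  define mu where "mu v j = c v + k * card (N v) * (real j + 1) / n" for v and j :: nat
  define h1 where "h1 = (\<lambda>(v, j) u i. of_bool (u \<in> N v \<and> i \<in> {i. n \<le> i + j + 1}) :: real)"
  \<comment> \<open>The interval is widened by \<open>k * t\<close> on both sides, the amount by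
    which a value may differ from \<open>mu v (x v)\<close>. Ends in \<open>{0..int B}\<close> leave
    finitely many tests; other intervals are clipped to this range.\<close>
  define h2 where "h2 = (\<lambda>(A, a::int, b::int) v j. of_bool (v \<in> A \<and> a - k * t \<le> mu v j \<and> mu v j \<le> b + k * t) :: real)"
  define H where "H = h1 ` (V \<times> {..<n}) \<union> h2 ` ({V,R} \<times> {0..int B} \<times> {0..int B})"
  have fH: "finite H" using assms(1) by (simp add: H_def)
  have "card H \<le> card (h1 ` (V \<times> {..<n})) + card (h2 ` ({V,R} \<times> {0..int B} \<times> {0..int B}))"
    unfolding H_def by (rule card_Un_le)
  also have "\<dots> \<le> card (V \<times> {..<n}) + card ({V,R} \<times> {0..int B} \<times> {0..int B})"
    using assms(1) by (intro add_mono card_image_le) auto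
  also have "\<dots> \<le> n * n + 2 * ((B + 1) * (B + 1))"
    by (simp add: card_cartesian_product n_def nat_add_distrib card_insert_if)
  finally have "real (card H) \<le> real (n * n + 2 * ((B + 1) * (B + 1)))" by linarith
  then have cH: "2 * real (card H) \<le> exp L" using L(1) by (simp add: n_def power2_eq_square algebra_simps)
  have "\<exists>x. (\<forall>v\<in>V. x v \<in> {..<n}) \<and>
           (\<forall>h\<in>H. \<bar>(\<Sum>v\<in>V. h v (x v)) - (\<Sum>v\<in>V. (\<Sum>j\<in>{..<n}. h v j) / card {..<n})\<bar> \<le> 2 * sqrt (card V * L))"
  proof (rule exists_balanced_function)
    show "0 \<le> h v x \<and> h v x \<le> 1" if "h \<in> H" for h v x
      using that by (auto simp: H_def h1_def h2_def)
  qed (use assms fH cH n in auto)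
  then obtain x where x: "\<And>v. v \<in> V \<Longrightarrow> x v < n"
    "\<And>h. h \<in> H \<Longrightarrow> \<bar>(\<Sum>v\<in>V. h v (x v)) - (\<Sum>v\<in>V. (\<Sum>j\<in>{..<n}. h v j) / n)\<bar> \<le> t"
    unfolding t_def by auto
  define y where "y v = c v + int k * int (card {u \<in> N v. n \<le> x u + x v + 1})" for v
  have near: "\<bar>y v - mu v (x v)\<bar> \<le> k * t" if v: "v \<in> V" for v
  proof -
    have "h1 (v, x v) \<in> H" using v x(1) by (auto simp: H_def)
    from x(2)[OF this] have "\<bar>(\<Sum>u\<in>V. h1 (v, x v) u (x u)) - (\<Sum>u\<in>V. (\<Sum>j\<in>{..<n}. h1 (v, x v) u j) / n)\<bar> \<le> t" .
    moreover have "(\<Sum>u\<in>V. h1 (v, x v) u (x u)) = real (card {u \<in> V \<inter> N v. x u \<in> {i. n \<le> i + x v + 1}})"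
      unfolding h1_def prod.case by (rule sum_of_bool_conj[OF assms(1)])
    moreover have "{u \<in> V \<inter> N v. x u \<in> {i. n \<le> i + x v + 1}} = {u \<in> N v. n \<le> x u + x v + 1}"
      using assms(4) by auto
    moreover have "(\<Sum>u\<in>V. (\<Sum>j\<in>{..<n}. h1 (v, x v) u j) / n) =
        real (card (N v)) * real (card ({..<n} \<inter> {i. n \<le> i + x v + 1})) / n"
      unfolding h1_def prod.case by (rule average_of_bool_conj[OF assms(1) _ assms(4)]) simp
    \<comment> \<open>With the summand 1 in the threshold exactly \<open>x v + 1\<close> of the
      \<open>n\<close> labels pass, in agreement with \<open>mu\<close>.\<close>
    moreover have "card ({..<n} \<inter> {i. n \<le> i + x v + 1}) = x v + 1"
    proof -
      have "{..<n} \<inter> {i. n \<le> i + x v + 1} = {n - (x v + 1)..<n}" using x(1)[OF v] by auto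
      then show ?thesis using x(1)[OF v] by simp
    qed
    ultimately have "\<bar>real (card {u \<in> N v. n \<le> x u + x v + 1}) - real (card (N v)) * (real (x v) + 1) / n\<bar> \<le> t"
      by (simp add: add.commute)
    then have "real k * \<bar>real (card {u \<in> N v. n \<le> x u + x v + 1}) - real (card (N v)) * (real (x v) + 1) / n\<bar> \<le> k * t"
      by (intro mult_left_mono) auto
    moreover have "y v - mu v (x v) = real k * (real (card {u \<in> N v. n \<le> x u + x v + 1}) - real (card (N v)) * (real (x v) + 1) / n)"
      by (simp add: y_def mu_def algebra_simps)
    ultimately show ?thesis by (simp add: abs_mult)
  qed
  have yB: "0 \<le> y v \<and> y v \<le> int B" if "v \<in> V" for v
  proof -
    have "card {u \<in> N v. n \<le> x u + x v + 1} \<le> card (N v)"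
      using finite_subset[OF assms(4) assms(1)] by (intro card_mono) auto
    then have "int k * int (card {u \<in> N v. n \<le> x u + x v + 1}) \<le> int k * int (card (N v))"
      by (intro mult_left_mono) auto
    then show ?thesis using c[OF that] by (simp add: y_def)
  qed
  have main: "real (card {v \<in> A. a \<le> y v \<and> y v \<le> b}) \<le> card A / n * (b - a) / (1 + e) + 2 * k * t + t + 1"
    if A: "A \<in> {V,R}" and ab: "a \<in> {0..int B}" "b \<in> {0..int B}" "a \<le> b" for A a b
  proof -
    have AV: "A \<subseteq> V" using A assms(3) by auto
    have fA: "finite A" using AV assms(1) finite_subset by blast
    have cA: "card A \<le> n" using AV assms(1) by (simp add: n_def card_mono)
    define w where "w = (b - a) + 2 * k * t"
    have w0: "w \<ge> 0" using ab t0 by (simp add: w_def)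
    define J where "J v = {j \<in> {..<n}. a - k * t \<le> mu v j \<and> mu v j \<le> b + k * t}" for v
    \<comment> \<open>Elements of \<open>J v\<close> have \<open>mu\<close>-values in an interval of
      length \<open>w\<close>, and the slope \<open>s\<close> is at least \<open>1 + e\<close>, so
      they differ by at most \<open>w / (1 + e)\<close>.\<close>
    have cJ: "real (card (J v)) \<le> w / (1 + e) + 1" if v: "v \<in> V" for v
    proof (rule card_le_diameter)
      fix i j assume ij: "i \<in> J v" "j \<in> J v"
      define s where "s = real k * card (N v) / n"
      have s: "s \<ge> 1 + e" using deg[OF v] n by (simp add: s_def n_def field_simps)
      have "mu v l = c v + s * (real l + 1)" for l by (simp add: mu_def s_def)
      then have "s * (real i - real j) = mu v i - mu v j" by (simp add: algebra_simps)
      also have "\<dots> \<le> w" using ij by (simp add: J_def w_def)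
      finally have sw: "s * (real i - real j) \<le> w" .
      show "real i - real j \<le> w / (1 + e)"
      proof (cases "real i - real j \<ge> 0")
        case True
        then have "(1 + e) * (real i - real j) \<le> s * (real i - real j)" using s by (intro mult_right_mono)
        then show ?thesis using sw assms(5) by (simp add: field_simps)
      next
        case False
        then show ?thesis using w0 assms(5) by (smt (verit) divide_nonneg_nonneg)
      qed
    qed (use w0 assms(5) in \<open>auto simp: J_def\<close>)
    have inner: "(\<Sum>j<n. h2 (A, a, b) v j) = (if v \<in> A then real (card (J v)) else 0)" for v
      by (auto simp: h2_def J_def Int_def)
    have "(\<Sum>v\<in>V. (\<Sum>j<n. h2 (A, a, b) v j) / n) = (\<Sum>v\<in>V. if v \<in> A then real (card (J v)) / n else 0)"
      unfolding inner by (intro sum.cong) auto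
    also have "\<dots> = (\<Sum>v\<in>A. real (card (J v)) / n)"
      using assms(1) AV by (simp add: sum.inter_restrict[symmetric] Int_absorb1)
    also have "\<dots> \<le> (\<Sum>v\<in>A. (w / (1 + e) + 1) / n)"
      using cJ AV by (intro sum_mono divide_right_mono) auto
    also have "\<dots> = card A / n * (w / (1 + e)) + card A / n"
      by (simp add: field_simps add_divide_distrib)
    also have "\<dots> \<le> card A / n * (w / (1 + e)) + 1" using cA n by simp
    finally have avg: "(\<Sum>v\<in>V. (\<Sum>j<n. h2 (A, a, b) v j) / n) \<le> card A / n * (w / (1 + e)) + 1" .
    have "h2 (A, a, b) \<in> H" using A ab by (auto simp: H_def)
    from x(2)[OF this] avg have 1: "(\<Sum>v\<in>V. h2 (A, a, b) v (x v)) \<le> card A / n * (w / (1 + e)) + 1 + t" by linarith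
    have "{v \<in> A. a \<le> y v \<and> y v \<le> b} \<subseteq> {v \<in> V \<inter> A. a - k * t \<le> mu v (x v) \<and> mu v (x v) \<le> b + k * t}"
    proof
      fix v assume v: "v \<in> {v \<in> A. a \<le> y v \<and> y v \<le> b}"
      then have "v \<in> V" using AV by auto
      moreover have "real_of_int a \<le> real_of_int (y v)" "real_of_int (y v) \<le> real_of_int b" using v by auto
      ultimately show "v \<in> {v \<in> V \<inter> A. a - k * t \<le> mu v (x v) \<and> mu v (x v) \<le> b + k * t}"
        using near[of v] v by (auto simp: abs_le_iff)
    qed
    then have "card {v \<in> A. a \<le> y v \<and> y v \<le> b} \<le> card {v \<in> V \<inter> A. a - k * t \<le> mu v (x v) \<and> mu v (x v) \<le> b + k * t}"
      using assms(1) by (intro card_mono) auto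
    also have "real \<dots> = (\<Sum>v\<in>V. h2 (A, a, b) v (x v))"
      unfolding h2_def prod.case by (rule sum_of_bool_conj[OF assms(1), symmetric])
    finally have 2: "real (card {v \<in> A. a \<le> y v \<and> y v \<le> b}) \<le> card A / n * (w / (1 + e)) + 1 + t"
      using 1 by linarith
    have "card A / n * (w / (1 + e)) = card A / n * (b - a) / (1 + e) + card A / n * (2 * k * t) / (1 + e)"
      unfolding w_def by (simp add: add_divide_distrib distrib_left)
    moreover have "card A / n * (2 * k * t) / (1 + e) \<le> 2 * k * t"
    proof -
      have "card A / n * (2 * k * t) \<le> 1 * (2 * k * t)" using cA n t0 by (intro mult_right_mono) auto
      also have "\<dots> \<le> (2 * k * t) * (1 + e)" using t0 assms(5) by (simp add: algebra_simps)
      finally show ?thesis using assms(5) by (subst pos_divide_le_eq) auto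
    qed
    ultimately show ?thesis using 2 unfolding of_int_diff by linarith
  qed
  have "real (card {v \<in> A. a \<le> y v \<and> y v \<le> b}) \<le> card A / n * (b - a) / (1 + e) + 2 * k * t + t + 1"
    if A: "A \<in> {V,R}" and ab: "a \<le> b" for A a b
  proof -
    have AV: "A \<subseteq> V" using A assms(3) by auto
    \<comment> \<open>All values lie in \<open>{0..int B}\<close>, so clipping the interval does not
      change the count.\<close>
    define a' where "a' = max a 0"
    define b' where "b' = min b (int B)"
    have eq: "{v \<in> A. a \<le> y v \<and> y v \<le> b} = {v \<in> A. a' \<le> y v \<and> y v \<le> b'}"
      using AV yB by (auto simp: a'_def b'_def)
    have pos: "0 \<le> card A / n * (b - a) / (1 + e)" using ab assms(5) by simp
    show ?thesis
    proof (cases "a' \<le> b'")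
      case True
      then have 1: "real (card {v \<in> A. a' \<le> y v \<and> y v \<le> b'}) \<le> card A / n * (b' - a') / (1 + e) + 2 * k * t + t + 1"
        using main[OF A, of a' b'] by (auto simp: a'_def b'_def)
      have "card A / n * (b' - a') / (1 + e) \<le> card A / n * (b - a) / (1 + e)"
        using assms(5) by (intro divide_right_mono mult_left_mono) (auto simp: a'_def b'_def)
      then show ?thesis using 1 unfolding eq of_int_diff by linarith
    next
      case False
      then have "{v \<in> A. a' \<le> y v \<and> y v \<le> b'} = {}" by auto
      then have "real (card {v \<in> A. a' \<le> y v \<and> y v \<le> b'}) = 0" by (simp only: card.empty of_nat_0)
      moreover have "0 \<le> 2 * k * t" using t0 by simp
      ultimately show ?thesis unfolding eq using pos t0 unfolding of_int_diff by linarith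
    qed
  qed
  then show ?thesis unfolding y_def n_def by (intro exI[of _ x]) blast
qed

section \<open>Codegrees and transfers along a path system\<close>

text \<open>Adding \<open>v\<close> creates an overlap of at most \<open>card A * s\<close> with the
  union so far, and \<open>card A + (card A)^2 <= (card A + 1)^2\<close>.\<close>

lemma sum_card_le_union:
  fixes N :: "'a \<Rightarrow> 'b set" and s :: real
  assumes "finite A" "\<And>v. v \<in> A \<Longrightarrow> finite (N v)" "0 \<le> s"
    and "\<And>u v. u \<in> A \<Longrightarrow> v \<in> A \<Longrightarrow> u \<noteq> v \<Longrightarrow> real (card (N u \<inter> N v)) \<le> s"
  shows "(\<Sum>v\<in>A. real (card (N v))) \<le> real (card (\<Union>v\<in>A. N v)) + real (card A)^2 * s"
  using assms(1,2,4)
proof (induction A rule: finite_induct)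
  case empty
  then show ?case by simp
next
  case (insert v A)
  have IH: "(\<Sum>v\<in>A. real (card (N v))) \<le> real (card (\<Union>v\<in>A. N v)) + real (card A)^2 * s"
    by (rule insert.IH) (use insert.prems in auto)
  let ?U = "\<Union>v\<in>A. N v"
  have fU: "finite ?U" using insert by auto
  have fv: "finite (N v)" using insert by auto
  have eq: "card (N v) + card ?U = card (N v \<union> ?U) + card (N v \<inter> ?U)"
    using card_Un_Int[OF fv fU] .
  have "N v \<inter> ?U = (\<Union>u\<in>A. N v \<inter> N u)" by auto
  then have "card (N v \<inter> ?U) \<le> (\<Sum>u\<in>A. card (N v \<inter> N u))"
    by (simp only: card_UN_le[OF insert.hyps(1)])
  then have "real (card (N v \<inter> ?U)) \<le> (\<Sum>u\<in>A. real (card (N v \<inter> N u)))"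
    unfolding of_nat_sum[symmetric] of_nat_le_iff .
  also have "\<dots> \<le> (\<Sum>u\<in>A. s)"
  proof (rule sum_mono)
    fix u assume "u \<in> A"
    then show "real (card (N v \<inter> N u)) \<le> s" using insert.prems(2)[of v u] insert.hyps(2) by auto
  qed
  finally have int: "real (card (N v \<inter> ?U)) \<le> real (card A) * s" by simp
  have "(\<Sum>v\<in>insert v A. real (card (N v))) = real (card (N v)) + (\<Sum>v\<in>A. real (card (N v)))"
    using insert.hyps by simp
  also have "\<dots> \<le> real (card (N v)) + real (card ?U) + real (card A)^2 * s" using IH by simp
  also have "real (card (N v)) + real (card ?U) = real (card (N v \<union> ?U)) + real (card (N v \<inter> ?U))"
    using eq by linarith
  also have "\<dots> + real (card A)^2 * s \<le> real (card (N v \<union> ?U)) + real (card A) * s + real (card A)^2 * s"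
    using int by simp
  also have "\<dots> \<le> real (card (N v \<union> ?U)) + real (card (insert v A))^2 * s"
    using insert.hyps assms(3) by (simp add: power2_eq_square algebra_simps)
  finally show ?case by simp
qed

text \<open>\<open>K\<close> neighbourhoods of size at least \<open>n / (K - 1)\<close> have total
  size at least \<open>n + n / (K - 1)\<close>. With all pairwise intersections below
  \<open>n / K^3\<close> the total would be at most \<open>n + n / K\<close>.\<close>

lemma exists_large_codegree:
  fixes N :: "'a \<Rightarrow> 'a set" and K :: nat
  assumes "finite V" "V \<noteq> {}" "\<And>v. N v \<subseteq> V" "2 \<le> K" "A \<subseteq> V" "card A = K"
    and deg: "\<And>v. v \<in> V \<Longrightarrow> real (card V) / (real K - 1) \<le> real (card (N v))"
  shows "\<exists>u\<in>A. \<exists>v\<in>A. u \<noteq> v \<and> real (card V) / real K^3 \<le> real (card (N u \<inter> N v))"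
proof (rule ccontr)
  assume no: "\<not> ?thesis"
  define n where "n = real (card V)"
  have n: "n > 0" using assms(1,2) by (simp add: n_def card_gt_0_iff)
  have fA: "finite A" using assms(1,5) finite_subset by blast
  have "(\<Sum>v\<in>A. real (card (N v))) \<le> real (card (\<Union>v\<in>A. N v)) + real (card A)^2 * (n / real K^3)"
  proof (rule sum_card_le_union[OF fA])
    show "finite (N v)" for v using assms(1,3) finite_subset by blast
    show "real (card (N u \<inter> N v)) \<le> n / real K^3" if "u \<in> A" "v \<in> A" "u \<noteq> v" for u v
      using no that unfolding n_def by force
  qed (use n in simp)
  also have "real (card (\<Union>v\<in>A. N v)) \<le> n"
    unfolding n_def of_nat_le_iff using assms(1,3) by (intro card_mono) auto
  also have "real (card A)^2 * (n / real K^3) = n / K"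
    using assms(4,6) by (simp add: power2_eq_square power3_eq_cube)
  finally have up: "(\<Sum>v\<in>A. real (card (N v))) \<le> n + n / K" by simp
  have "real K * (n / (real K - 1)) = (\<Sum>v\<in>A. n / (real K - 1))" using assms(6) by simp
  also have "\<dots> \<le> (\<Sum>v\<in>A. real (card (N v)))"
    using deg assms(5) by (intro sum_mono) (auto simp: n_def)
  finally have "real K * (n / (real K - 1)) \<le> n + n / K" using up by linarith
  moreover have "real K * (n / (real K - 1)) = n + n / (real K - 1)"
    using assms(4) by (simp add: field_simps)
  moreover have "n / real K < n / (real K - 1)" using n assms(4) by (intro divide_strict_left_mono) auto
  ultimately show False by linarith
qed

text \<open>There are at least \<open>(n / (K - 1))^2\<close> walks of length two from
  \<open>v\<close>, and their number is the sum of the codegrees with \<open>v\<close>. If fewer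
  than \<open>K\<close> vertices had large codegree, the sum would be at most
  \<open>K * n + n^2 / K^3\<close>, which is too small once \<open>n > K^4\<close>.\<close>

lemma card_large_codegree:
  fixes N :: "'a \<Rightarrow> 'a set" and K :: nat
  assumes "finite V" "\<And>v. N v \<subseteq> V" "\<And>u v. u \<in> N v \<longleftrightarrow> v \<in> N u" "2 \<le> K" "v \<in> V"
    and deg: "\<And>v. v \<in> V \<Longrightarrow> real (card V) / (real K - 1) \<le> real (card (N v))"
    and big: "real K^4 < real (card V)"
  shows "K \<le> card {u \<in> V. v \<noteq> u \<and> real (card V) / real K^3 \<le> real (card (N v \<inter> N u))}"
proof (rule ccontr)
  define n where "n = real (card V)"
  have n: "n > 0" using assms(1,5) by (auto simp: n_def card_gt_0_iff)
  define S where "S = {u \<in> V. v \<noteq> u \<and> n / real K^3 \<le> real (card (N v \<inter> N u))}"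
  assume "\<not> ?thesis"
  then have cS: "card S < K" by (simp add: S_def n_def)
  have fS: "finite S" using assms(1) by (simp add: S_def)
  have fN: "finite (N u)" for u using assms(1,2) finite_subset by blast
  have cN: "real (card (N v \<inter> N u)) \<le> n" for u
    unfolding n_def of_nat_le_iff using assms(1,2) by (intro card_mono) auto
  have "(\<Sum>u\<in>V. card (N v \<inter> N u)) = (\<Sum>u\<in>V. card {w \<in> N v. u \<in> N w})"
    using assms(3) by (intro sum.cong arg_cong[where f = card]) auto
  also have "\<dots> = (\<Sum>w\<in>N v. card {u \<in> V. u \<in> N w})"
    using sum_multicount_gen[of V "N v" "\<lambda>u w. u \<in> N w" "\<lambda>w. card {u \<in> V. u \<in> N w}"] assms(1) fN by simp
  also have "\<dots> = (\<Sum>w\<in>N v. card (N w))"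
    using assms(2) by (intro sum.cong arg_cong[where f = card]) auto
  finally have "(\<Sum>u\<in>V. real (card (N v \<inter> N u))) = (\<Sum>w\<in>N v. real (card (N w)))"
    unfolding of_nat_sum[symmetric] by (rule arg_cong)
  also have "\<dots> \<ge> (\<Sum>w\<in>N v. n / (real K - 1))"
    using deg assms(2) by (intro sum_mono) (auto simp: n_def)
  finally have "real (card (N v)) * (n / (real K - 1)) \<le> (\<Sum>u\<in>V. real (card (N v \<inter> N u)))" by simp
  moreover have "n / (real K - 1) * (n / (real K - 1)) \<le> real (card (N v)) * (n / (real K - 1))"
    using deg[OF assms(5)] n assms(4) by (intro mult_right_mono) (auto simp: n_def)
  \<comment> \<open>\<open>v\<close> joins the exceptional vertices, since its codegree with itself
    is its degree; there are still at most \<open>K\<close> of them.\<close>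
  moreover have "(\<Sum>u\<in>V. real (card (N v \<inter> N u))) \<le> (\<Sum>u\<in>V. (if u \<in> insert v S then n else 0) + n / real K^3)"
  proof (rule sum_mono)
    fix u assume "u \<in> V"
    have 0: "0 \<le> n / real K^3" using n by simp
    show "real (card (N v \<inter> N u)) \<le> (if u \<in> insert v S then n else 0) + n / real K^3"
    proof (cases "u \<in> insert v S")
      case True
      then show ?thesis unfolding if_P[OF True] using 0 cN[of u] by linarith
    next
      case False
      then show ?thesis unfolding if_not_P[OF False] using \<open>u \<in> V\<close> by (auto simp: S_def)
    qed
  qed
  moreover have "(\<Sum>u\<in>V. (if u \<in> insert v S then n else 0) + n / real K^3) = real (card (insert v S)) * n + n * (n / real K^3)"
  proof -
    have "(\<Sum>u\<in>V. if u \<in> insert v S then n else 0) = (\<Sum>u\<in>V \<inter> insert v S. n)"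
      by (rule sum.inter_restrict[OF assms(1), symmetric])
    also have "V \<inter> insert v S = insert v S" using assms(5) by (auto simp: S_def)
    finally show ?thesis by (simp add: sum.distrib n_def)
  qed
  moreover have "real (card (insert v S)) * n \<le> real K * n"
  proof -
    have "card (insert v S) \<le> K" using cS fS by (simp add: card_insert_if)
    then show ?thesis using n by (intro mult_right_mono) auto
  qed
  ultimately have "n / (real K - 1) * (n / (real K - 1)) \<le> real K * n + n * (n / real K^3)" by linarith
  moreover have "n / real K * (n / real K) \<le> n / (real K - 1) * (n / (real K - 1))"
    using n assms(4) by (intro mult_mono divide_left_mono) auto
  ultimately have "n * (n / real K^2) \<le> n * (real K + n / real K^3)"
    by (simp add: power2_eq_square distrib_left mult.commute)
  then have "n / real K^2 \<le> real K + n / real K^3" using n by (rule mult_left_le_imp_le)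
  then have "real K^3 * (n / real K^2) \<le> real K^3 * (real K + n / real K^3)" by (intro mult_left_mono) auto
  then have "real K * n \<le> real K^4 + n"
    using assms(4) by (simp add: power2_eq_square power3_eq_cube power4_eq_xxxx algebra_simps)
  moreover have "2 * n \<le> real K * n" using n assms(4) by (intro mult_right_mono) auto
  ultimately show False using big by (simp add: n_def)
qed

text \<open>Transfers on different paths are superposed. Each vertex \<open>v\<close> lies on one
  path, so at most one summand of \<open>g v w\<close> is nonzero; a middle vertex may serve several
  paths, as its sum vanishes for each of them.\<close>

lemma system_transfer:
  fixes s :: "'a \<Rightarrow> int" and M :: nat
  assumes "finite V" "\<And>v. Mid v \<subseteq> V" and P: "path_system H V P"
    and H: "\<And>u v. H u v \<Longrightarrow> 2 * M \<le> card (Mid u \<inter> Mid v)"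
    and pre: "\<And>p i. p \<in> P \<Longrightarrow> \<bar>\<Sum>v\<leftarrow>take i p. s v\<bar> \<le> int M"
    and tot: "\<And>p. p \<in> P \<Longrightarrow> (\<Sum>v\<leftarrow>p. s v) = 0"
  shows "\<exists>g. (\<forall>v w. g v w \<in> {-1, 0, 1::int}) \<and>
           (\<forall>v w. g v w \<noteq> 0 \<longrightarrow> v \<in> V \<and> w \<in> Mid v) \<and>
           (\<forall>w. (\<Sum>v\<in>V. g v w) = 0) \<and> (\<forall>v\<in>V. (\<Sum>w\<in>V. g v w) = s v)"
proof -
  have fP: "finite P" and cov: "(\<Union>p\<in>P. set p) = V"
    and dj: "\<And>p q. p \<in> P \<Longrightarrow> q \<in> P \<Longrightarrow> p \<noteq> q \<Longrightarrow> set p \<inter> set q = {}"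
    using P by (auto simp: path_system_def)
  have "\<forall>p\<in>P. \<exists>g. (\<forall>v w. g v w \<in> {-1, 0, 1::int}) \<and>
           (\<forall>v w. g v w \<noteq> 0 \<longrightarrow> v \<in> set p \<and> w \<in> Mid v) \<and>
           (\<forall>w. (\<Sum>v\<in>set p. g v w) = 0) \<and> (\<forall>v\<in>set p. (\<Sum>w\<in>V. g v w) = s v)"
  proof
    fix p assume p: "p \<in> P"
    then have "p \<noteq> []" "distinct p" "successively (\<lambda>a b. 2 * M \<le> card (Mid a \<inter> Mid b)) p"
      using P H by (auto simp: path_system_def intro: successively_mono)
    from path_transfer[OF assms(1,2) this pre[OF p] tot[OF p]]
    show "\<exists>g. (\<forall>v w. g v w \<in> {-1, 0, 1::int}) \<and>
           (\<forall>v w. g v w \<noteq> 0 \<longrightarrow> v \<in> set p \<and> w \<in> Mid v) \<and>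
           (\<forall>w. (\<Sum>v\<in>set p. g v w) = 0) \<and> (\<forall>v\<in>set p. (\<Sum>w\<in>V. g v w) = s v)" by blast
  qed
  then obtain G where "\<forall>p\<in>P. (\<forall>v w. G p v w \<in> {-1, 0, 1::int}) \<and>
           (\<forall>v w. G p v w \<noteq> 0 \<longrightarrow> v \<in> set p \<and> w \<in> Mid v) \<and>
           (\<forall>w. (\<Sum>v\<in>set p. G p v w) = 0) \<and> (\<forall>v\<in>set p. (\<Sum>w\<in>V. G p v w) = s v)"
    using bchoice[of P "\<lambda>p g. (\<forall>v w. g v w \<in> {-1, 0, 1::int}) \<and>
           (\<forall>v w. g v w \<noteq> 0 \<longrightarrow> v \<in> set p \<and> w \<in> Mid v) \<and>
           (\<forall>w. (\<Sum>v\<in>set p. g v w) = 0) \<and> (\<forall>v\<in>set p. (\<Sum>w\<in>V. g v w) = s v)"] by blast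
  then have G1: "\<And>p v w. p \<in> P \<Longrightarrow> G p v w \<in> {-1, 0, 1::int}"
    and G2: "\<And>p v w. p \<in> P \<Longrightarrow> G p v w \<noteq> 0 \<Longrightarrow> v \<in> set p \<and> w \<in> Mid v"
    and G3: "\<And>p w. p \<in> P \<Longrightarrow> (\<Sum>v\<in>set p. G p v w) = 0"
    and G4: "\<And>p v. p \<in> P \<Longrightarrow> v \<in> set p \<Longrightarrow> (\<Sum>w\<in>V. G p v w) = s v"
    by blast+
  define g where "g v w = (\<Sum>p\<in>P. G p v w)" for v w
  have g: "g v w = G p v w" if "p \<in> P" "v \<in> set p" for p v w
  proof -
    have "G q v w = 0" if "q \<in> P - {p}" for q
      using that G2[of q v w] dj[of q p] \<open>p \<in> P\<close> \<open>v \<in> set p\<close> by blast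
    then have "(\<Sum>q\<in>P - {p}. G q v w) = 0" by (rule sum.neutral[OF ballI])
    then show ?thesis using fP that(1) by (simp add: g_def sum.remove)
  qed
  have g0: "g v w = 0" if "v \<notin> V" for v w
    unfolding g_def using that G2 cov by (intro sum.neutral) blast
  have 1: "g v w \<in> {-1, 0, 1}" for v w
  proof (cases "v \<in> V")
    case True
    then obtain p where "p \<in> P" "v \<in> set p" using cov by blast
    then show ?thesis using g G1 by metis
  qed (simp add: g0)
  have 2: "v \<in> V \<and> w \<in> Mid v" if nz: "g v w \<noteq> 0" for v w
  proof -
    have v: "v \<in> V" using g0 nz by blast
    then obtain p where "p \<in> P" "v \<in> set p" using cov by blast
    then show ?thesis using g G2 nz v by metis
  qed
  have 3: "(\<Sum>v\<in>V. g v w) = 0" for w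
  proof -
    have "(\<Sum>v\<in>V. g v w) = (\<Sum>p\<in>P. \<Sum>v\<in>V. G p v w)" unfolding g_def by (rule sum.swap)
    also have "\<dots> = (\<Sum>p\<in>P. \<Sum>v\<in>set p. G p v w)"
    proof (rule sum.cong[OF refl])
      fix p assume p: "p \<in> P"
      show "(\<Sum>v\<in>V. G p v w) = (\<Sum>v\<in>set p. G p v w)"
        by (rule sum.mono_neutral_right[OF assms(1)]) (use p cov G2[OF p] in blast)+
    qed
    also have "\<dots> = 0" using G3 by simp
    finally show ?thesis .
  qed
  have 4: "(\<Sum>w\<in>V. g v w) = s v" if v: "v \<in> V" for v
  proof -
    obtain p where "p \<in> P" "v \<in> set p" using cov v by blast
    then show ?thesis using g G4 by simp
  qed
  show ?thesis using 1 2 3 4 by (intro exI[of _ g]) blast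
qed

section \<open>Target degrees\<close>

lemma sum_list_take_nth:
  fixes s :: "'a \<Rightarrow> int"
  shows "(\<Sum>v\<leftarrow>take i p. s v) = (\<Sum>t<min i (length p). s (p ! t))"
  by (simp add: sum_list_sum_nth atLeast0LessThan min.commute)

text \<open>Every k-th vertex of a path owns two private slots, at distance about W below and above its
  value, and uses them to keep the running displacement bounded; the last two vertices of a path,
  with their reserved slots in U, bring the total displacement of the path to exactly 0.\<close>

lemma exists_targets:
  fixes \<sigma> :: "'a \<Rightarrow> int" and D0 D W B :: int and J k K :: nat
  assumes P: "path_system H V P" and len: "\<And>p. p \<in> P \<Longrightarrow> 2 \<le> length p" and cP: "card P \<le> K"
    and fV: "finite V" and k: "0 < k" and B: "0 < B" and D0: "0 \<le> D0"
    and R: "R = (\<Union>p\<in>P. (!) p ` {t. t < length p \<and> k dvd Suc t})"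
    and count: "\<And>a b. a \<le> b \<Longrightarrow> int (card {v\<in>V. a \<le> \<sigma> v \<and> \<sigma> v \<le> b}) +
        int (card {v\<in>R. a \<le> \<sigma> v - W \<and> \<sigma> v - W \<le> b}) +
        int (card {v\<in>R. a \<le> \<sigma> v + W \<and> \<sigma> v + W \<le> b}) \<le> b - a + D0"
    and D: "D0 + int K * (2 * int J + 1 + (4 * int K * B + 1)) \<le> D"
    and W: "int k * D \<le> W" "4 * int K * B \<le> 3 * W"
    and J: "2 * W + D + 4 * int K * B \<le> int J * B"
  shows "\<exists>f. inj_on f V \<and> (\<forall>p\<in>P. (\<forall>i. \<bar>\<Sum>v\<leftarrow>take i p. f v - \<sigma> v\<bar> \<le> 3 * W) \<and>
           (\<Sum>v\<leftarrow>p. f v - \<sigma> v) = 0)"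
proof -
  have fP: "finite P" and cov: "(\<Union>p\<in>P. set p) = V"
    and dp: "\<And>p. p \<in> P \<Longrightarrow> distinct p"
    and dj: "\<And>p q. p \<in> P \<Longrightarrow> q \<in> P \<Longrightarrow> p \<noteq> q \<Longrightarrow> set p \<inter> set q = {}"
    using P by (auto simp: path_system_def)
  have nthV: "p ! t \<in> V" if "p \<in> P" "t < length p" for p t using that cov nth_mem by blast
  have RV: "R \<subseteq> V" using nthV by (auto simp: R)
  have fR: "finite R" using RV fV finite_subset by blast
  have KB: "0 \<le> 4 * int K * B" using B by simp
  have D1: "0 \<le> D" 
  proof -
    have "0 \<le> int K * (2 * int J + 1 + (4 * int K * B + 1))" using KB by simp
    then show ?thesis using D D0 by linarith
  qed
  have DW: "D \<le> W"
  proof -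
    have "1 * D \<le> int k * D" using k D1 by (intro mult_right_mono) auto
    then show ?thesis using W by linarith
  qed
  \<comment> \<open>The last two vertices \<open>y p\<close> and \<open>z p\<close> do not take
    their values from \<open>T\<close>: they settle the account of the path.\<close>
  define y where "y p = p ! (length p - 2)" for p :: "'a list"
  define z where "z p = p ! (length p - 1)" for p :: "'a list"
  \<comment> \<open>Reserved values: \<open>y p\<close> moves in steps of \<open>B\<close> over a
    range wide enough for any running sum, and \<open>z p\<close> settles the remainder in a window
    of width \<open>4 * K * B\<close> below its value.\<close>
  define U1 where "U1 p = (\<lambda>i. \<sigma> (y p) + i * B) ` {- int J..int J}" for p
  define U2 where "U2 p = {\<sigma> (z p) - 4 * int K * B..\<sigma> (z p)}" for p
  define U where "U = (\<Union>p\<in>P. U1 p \<union> U2 p)"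
  have fU: "finite U" using fP by (simp add: U_def U1_def U2_def)
  have cU: "int (card U) \<le> int K * (2 * int J + 1 + (4 * int K * B + 1))"
  proof -
    have one: "int (card (U1 p \<union> U2 p)) \<le> 2 * int J + 1 + (4 * int K * B + 1)" for p
    proof -
      have "card (U1 p \<union> U2 p) \<le> card (U1 p) + card (U2 p)" by (rule card_Un_le)
      moreover have "card (U1 p) \<le> card {- int J..int J}" unfolding U1_def by (rule card_image_le) simp
      moreover have "int (card {- int J..int J}) = 2 * int J + 1" by simp
      moreover have "int (card (U2 p)) = 4 * int K * B + 1" using KB by (simp add: U2_def)
      ultimately show ?thesis by linarith
    qed
    have "card U \<le> (\<Sum>p\<in>P. card (U1 p \<union> U2 p))" unfolding U_def by (rule card_UN_le[OF fP])
    then have "int (card U) \<le> (\<Sum>p\<in>P. int (card (U1 p \<union> U2 p)))" unfolding of_nat_sum[symmetric] of_nat_le_iff .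
    also have "\<dots> \<le> (\<Sum>p\<in>P. 2 * int J + 1 + (4 * int K * B + 1))" by (intro sum_mono one)
    also have "\<dots> = int (card P) * (2 * int J + 1 + (4 * int K * B + 1))" by simp
    also have "\<dots> \<le> int K * (2 * int J + 1 + (4 * int K * B + 1))"
      using cP KB by (intro mult_right_mono) auto
    finally show ?thesis .
  qed
  \<comment> \<open>Index 0 is the ordinary slot near the value of a vertex; 1 and 2 are the slots
    of vertices in \<open>R\<close> shifted by \<open>-W\<close> and \<open>W\<close>.\<close>
  define I where "I = V \<times> {0::nat} \<union> R \<times> {1,2}"
  define sh where "sh c = (if c = (1::nat) then - W else if c = 2 then W else 0)" for c
  define r where "r i = \<sigma> (fst i) + sh (snd i)" for i :: "'a \<times> nat"
  have fI: "finite I" using fV fR by (simp add: I_def)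
  have "\<exists>T. inj_on T I \<and> T ` I \<inter> U = {} \<and> (\<forall>i\<in>I. r i \<le> T i \<and> T i \<le> r i + D0 + int (card U))"
  proof (rule exists_slots[OF fI fU _ D0])
    fix a b :: int assume ab: "a \<le> b"
    let ?A = "(\<lambda>v. (v, 0::nat)) ` {v\<in>V. a \<le> \<sigma> v \<and> \<sigma> v \<le> b}"
    let ?B = "(\<lambda>v. (v, 1::nat)) ` {v\<in>R. a \<le> \<sigma> v - W \<and> \<sigma> v - W \<le> b}"
    let ?C = "(\<lambda>v. (v, 2::nat)) ` {v\<in>R. a \<le> \<sigma> v + W \<and> \<sigma> v + W \<le> b}"
    have "{i \<in> I. a \<le> r i \<and> r i \<le> b} \<subseteq> ?A \<union> ?B \<union> ?C"
      by (auto simp: I_def r_def sh_def)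
    then have "card {i \<in> I. a \<le> r i \<and> r i \<le> b} \<le> card (?A \<union> ?B \<union> ?C)"
      using fV fR by (intro card_mono) auto
    also have "\<dots> \<le> card ?A + card ?B + card ?C"
      by (meson add_le_mono card_Un_le le_refl order_trans)
    also have "\<dots> = card {v\<in>V. a \<le> \<sigma> v \<and> \<sigma> v \<le> b} + card {v\<in>R. a \<le> \<sigma> v - W \<and> \<sigma> v - W \<le> b} +
        card {v\<in>R. a \<le> \<sigma> v + W \<and> \<sigma> v + W \<le> b}"
      by (simp add: card_image inj_on_def)
    finally show "int (card {i \<in> I. a \<le> r i \<and> r i \<le> b}) \<le> b - a + D0" using count[OF ab] by linarith
  qed
  then obtain T where T: "inj_on T I" "T ` I \<inter> U = {}"
    and T0: "\<forall>i\<in>I. r i \<le> T i \<and> T i \<le> r i + D0 + int (card U)" by blast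
  have T3: "r i \<le> T i \<and> T i \<le> r i + D" if "i \<in> I" for i
    using T0 that cU D by fastforce
  \<comment> \<open>The default \<open>sh c\<close> makes the bounds hold for every
    \<open>t\<close>, since the prefix choice works with infinite sequences.\<close>
  define e where "e p c t = (if t < length p \<and> (p ! t, c) \<in> I then T (p ! t, c) - \<sigma> (p ! t) else sh c)"
    for p :: "'a list" and c t
  have eb: "sh c \<le> e p c t \<and> e p c t \<le> sh c + D" for p c t
    using T3[of "(p ! t, c)"] D1 by (auto simp: e_def r_def)
  have "\<exists>c. (\<forall>t. c t \<in> (if Suc t mod k = 0 then {1,2} else {0})) \<and>
           (\<forall>m. \<bar>\<Sum>t<m. e p (c t) t\<bar> \<le> 2 * W + D)" for p
  proof (rule bounded_prefix_choice[OF k D1 W(1)])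
    show "0 \<le> e p 0 t \<and> e p 0 t \<le> D" for t using eb[of 0 p t] by (simp add: sh_def)
    show "- W \<le> e p 1 t \<and> e p 1 t \<le> - W + D" for t using eb[of 1 p t] by (simp add: sh_def)
    show "W \<le> e p 2 t \<and> e p 2 t \<le> W + D" for t using eb[of 2 p t] by (simp add: sh_def)
  qed
  then obtain c where c1: "\<And>p t. c p t \<in> (if Suc t mod k = 0 then {1,2} else {0})"
    and c2: "\<And>p m. \<bar>\<Sum>t<m. e p (c p t) t\<bar> \<le> 2 * W + D" by metis
  have cI: "(p ! t, c p t) \<in> I" if "p \<in> P" "t < length p" for p t
  proof (cases "Suc t mod k = 0")
    case True
    then have "p ! t \<in> R" using that by (auto simp: R)
    moreover have "c p t \<in> {1,2}" using c1[of p t] True by simp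
    ultimately show ?thesis by (auto simp: I_def)
  next
    case False
    then show ?thesis using c1[of p t] nthV[OF that] by (simp add: I_def)
  qed
  define S where "S p = (\<Sum>t<length p - 2. e p (c p t) t)" for p
  \<comment> \<open>Starting the search at \<open>- (S p div B)\<close> keeps
    \<open>S p + i p * B\<close> between 0 and \<open>4 * K * B\<close>, so that the value of
    \<open>z p\<close> falls into \<open>U2 p\<close>. The displacements of \<open>y p\<close> and
    \<open>z p\<close> add up to \<open>- S p\<close>.\<close>
  obtain i where i1: "\<And>p. p \<in> P \<Longrightarrow> - (S p div B) \<le> i p \<and> i p < - (S p div B) + 4 * int K"
    and i2: "inj_on (\<lambda>(p, b). if b then \<sigma> (y p) + i p * B else \<sigma> (z p) - S p - i p * B) (P \<times> UNIV)"
    using distinct_pair_choice[OF fP cP B, of "\<lambda>p. - (S p div B)" "\<lambda>p. \<sigma> (y p)" "\<lambda>p. \<sigma> (z p) - S p"] by blast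
  have Si: "0 \<le> S p + i p * B \<and> S p + i p * B \<le> 4 * int K * B" if "p \<in> P" for p
  proof -
    have "S p = S p div B * B + S p mod B" by simp
    then have eq: "S p + i p * B = (S p div B + i p) * B + S p mod B" by (simp add: algebra_simps)
    have m: "0 \<le> S p mod B" "S p mod B < B" using B by auto
    have "0 \<le> (S p div B + i p) * B" using i1[OF that] B by simp
    moreover have "(S p div B + i p) * B \<le> (4 * int K - 1) * B" using i1[OF that] B by (intro mult_right_mono) auto
    moreover have "(4 * int K - 1) * B = 4 * int K * B - B" by (simp add: algebra_simps)
    ultimately show ?thesis using eq m by linarith
  qed
  have iJ: "i p \<in> {- int J..int J}" if "p \<in> P" for p
  proof -
    have "\<bar>S p\<bar> \<le> 2 * W + D" using c2 by (simp add: S_def)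
    then have "\<bar>i p * B\<bar> \<le> int J * B" using Si[OF that] J by linarith
    then have "\<bar>i p\<bar> * B \<le> int J * B" using B by (simp add: abs_mult)
    then have "\<bar>i p\<bar> \<le> int J" using B by simp
    then show ?thesis by auto
  qed
  define val where "val = (\<lambda>(p, b). if b then \<sigma> (y p) + i p * B else \<sigma> (z p) - S p - i p * B)"
  have valU: "val (p, b) \<in> U" if p: "p \<in> P" for p b
  proof -
    have "\<sigma> (y p) + i p * B \<in> U1 p" using iJ[OF p] by (auto simp: U1_def)
    moreover have "\<sigma> (z p) - S p - i p * B \<in> U2 p" using Si[OF p] by (auto simp: U2_def)
    ultimately show ?thesis using p by (auto simp: U_def val_def)
  qed
  define F where "F p t = (if t = length p - 2 then val (p, True) else if t = length p - 1 then val (p, False)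
      else T (p ! t, c p t))" for p t
  \<comment> \<open>The paths partition the vertices, so \<open>loc\<close> recovers the path and
    the position of a vertex.\<close>
  define loc where "loc v = (SOME (p, t). p \<in> P \<and> t < length p \<and> v = p ! t)" for v
  have loc: "loc (p ! t) = (p, t)" if p: "p \<in> P" "t < length p" for p t
  proof -
    have "case loc (p ! t) of (q, u) \<Rightarrow> q \<in> P \<and> u < length q \<and> p ! t = q ! u"
      unfolding loc_def by (rule someI[of "\<lambda>(q, u). q \<in> P \<and> u < length q \<and> p ! t = q ! u" "(p, t)"]) (use p in simp)
    then obtain q u where qu: "loc (p ! t) = (q, u)" "q \<in> P" "u < length q" "p ! t = q ! u"
      by (cases "loc (p ! t)") auto
    have "q = p"
    proof (rule ccontr)
      assume "q \<noteq> p"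
      then have "set q \<inter> set p = {}" using dj qu p by blast
      moreover have "p ! t \<in> set p" using p by simp
      moreover have "p ! t \<in> set q" unfolding qu(4) using qu(3) by simp
      ultimately show False by blast
    qed
    then have "u = t" using qu(3,4) p(2) nth_eq_iff_index_eq[OF dp[OF p(1)], of t u] by simp
    then show ?thesis using qu(1) \<open>q = p\<close> by simp
  qed
  define f where "f v = (case loc v of (p, t) \<Rightarrow> F p t)" for v
  have f: "f (p ! t) = F p t" if "p \<in> P" "t < length p" for p t
    using loc[OF that] by (simp add: f_def)
  have pos: "\<exists>p t. p \<in> P \<and> t < length p \<and> v = p ! t" if "v \<in> V" for v
    using that cov by (metis UN_E in_set_conv_nth)
  have inj: "inj_on f V"
  proof (rule inj_onI)
    fix v w assume v: "v \<in> V" and w: "w \<in> V" and eq: "f v = f w"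
    obtain p t where p: "p \<in> P" "t < length p" "v = p ! t" using pos[OF v] by blast
    obtain q u where q: "q \<in> P" "u < length q" "w = q ! u" using pos[OF w] by blast
    have Feq: "F p t = F q u" using eq f p q by simp
    have cases: "(\<exists>b. F p t = val (p, b) \<and> t = (if b then length p - 2 else length p - 1)) \<or>
        F p t = T (p ! t, c p t)" if "p \<in> P" for p t
      using len[OF that] by (auto simp: F_def)
    have TU: "T (p ! t, c p t) \<notin> U" if "p \<in> P" "t < length p" for p t
      using T(2) cI[OF that] by blast
    \<comment> \<open>Values from \<open>T\<close> avoid \<open>U\<close> and the closing values lie
      in \<open>U\<close>, so equal values are of the same kind, and each kind is injective.\<close>
    show "v = w"
    proof (cases "\<exists>b. F p t = val (p, b) \<and> t = (if b then length p - 2 else length p - 1)")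
      case True
      then obtain b where b: "F p t = val (p, b)" "t = (if b then length p - 2 else length p - 1)" by blast
      have "F q u \<in> U" unfolding Feq[symmetric] b(1) by (rule valU[OF p(1)])
      then have "F q u \<noteq> T (q ! u, c q u)" using TU[OF q(1,2)] by metis
      then obtain b' where b': "F q u = val (q, b')" "u = (if b' then length q - 2 else length q - 1)"
        using cases[OF q(1)] by blast
      have "val (p, b) = val (q, b')" unfolding b(1)[symmetric] b'(1)[symmetric] by (rule Feq)
      then have "(p, b) = (q, b')" using i2 p q unfolding val_def[symmetric] by (auto dest: inj_onD)
      then show ?thesis using b b' p q by simp
    next
      case False
      then have Tp: "F p t = T (p ! t, c p t)" using cases[OF p(1)] by blast
      then have "F q u \<notin> U" using TU[OF p(1,2)] Feq by simp
      then have "F q u = T (q ! u, c q u)" using cases[OF q(1)] valU[OF q(1)] by metis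
      then have "T (p ! t, c p t) = T (q ! u, c q u)" using Tp Feq by simp
      then have "(p ! t, c p t) = (q ! u, c q u)" using T(1) cI[OF p(1,2)] cI[OF q(1,2)] by (meson inj_onD)
      then show ?thesis using p q by simp
    qed
  qed
  have pre: "(\<forall>m. \<bar>\<Sum>v\<leftarrow>take m p. f v - \<sigma> v\<bar> \<le> 3 * W) \<and> (\<Sum>v\<leftarrow>p. f v - \<sigma> v) = 0" if p: "p \<in> P" for p
  proof -
    define l where "l = length p - 2"
    have l: "length p = Suc (Suc l)" using len[OF p] by (simp add: l_def)
    define Q where "Q m = (\<Sum>t<m. f (p ! t) - \<sigma> (p ! t))" for m
    have early: "Q m = (\<Sum>t<m. e p (c p t) t)" if "m \<le> l" for m
    proof -
      have "f (p ! t) - \<sigma> (p ! t) = e p (c p t) t" if "t < m" for t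
      proof -
        have t: "t < length p" "t \<noteq> length p - 2" "t \<noteq> length p - 1" using that \<open>m \<le> l\<close> l by auto
        then show ?thesis using f[OF p t(1)] cI[OF p t(1)] by (simp add: F_def e_def)
      qed
      then show ?thesis unfolding Q_def by (intro sum.cong) auto
    qed
    have Ql: "Q l = S p" using early[of l] by (simp add: S_def l_def)
    have yl: "y p = p ! l" "z p = p ! Suc l" using l by (simp_all add: y_def z_def)
    have Q1: "Q (Suc l) = S p + i p * B"
      using Ql f[OF p, of l] l yl by (simp add: Q_def F_def val_def)
    have Q2: "Q (Suc (Suc l)) = 0"
    proof -
      have "Q (Suc (Suc l)) = Q (Suc l) + (f (p ! Suc l) - \<sigma> (p ! Suc l))" by (simp add: Q_def)
      then show ?thesis using Q1 f[OF p, of "Suc l"] l yl by (simp add: F_def val_def)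
    qed
    have small: "\<bar>Q m\<bar> \<le> 3 * W" if m: "m \<le> length p" for m
    proof -
      consider "m \<le> l" | "m = Suc l" | "m = Suc (Suc l)" using m l by linarith
      then show ?thesis
      proof cases
        case 1
        then show ?thesis using early c2[of p m] DW by (simp add: abs_le_iff)
      next
        case 2
        then show ?thesis using Q1 Si[OF p] W(2) by simp
      next
        case 3
        then show ?thesis using Q2 DW D1 by simp
      qed
    qed
    have "(\<Sum>v\<leftarrow>take m p. f v - \<sigma> v) = Q (min m (length p))" for m
      by (simp add: sum_list_take_nth Q_def)
    moreover from this[of "length p"] have "(\<Sum>v\<leftarrow>p. f v - \<sigma> v) = 0" using Q2 l by simp
    ultimately show ?thesis using small by simp
  qed
  show ?thesis using inj pre by (intro exI[of _ f]) blast
qed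

section \<open>The weighting of a dense graph\<close>

text \<open>A path with \<open>l\<close> vertices has at most \<open>l div k\<close> positions
  \<open>t\<close> with \<open>k\<close> dividing \<open>t + 1\<close>. These are the vertices that
  receive two shifted slots.\<close>

lemma card_spaced_vertices:
  assumes P: "path_system H V P" and "0 < k"
  shows "card (\<Union>p\<in>P. (!) p ` {t. t < length p \<and> k dvd Suc t}) * k \<le> card V"
proof -
  have fP: "finite P" and cov: "(\<Union>p\<in>P. set p) = V" and dp: "\<And>p. p \<in> P \<Longrightarrow> distinct p"
    and dj: "\<And>p q. p \<in> P \<Longrightarrow> q \<in> P \<Longrightarrow> p \<noteq> q \<Longrightarrow> set p \<inter> set q = {}"
    using P by (auto simp: path_system_def)
  define X where "X p = (!) p ` {t. t < length p \<and> k dvd Suc t}" for p :: "'a list"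
  have "card (\<Union>p\<in>P. (!) p ` {t. t < length p \<and> k dvd Suc t}) \<le> (\<Sum>p\<in>P. card (X p))"
    unfolding X_def by (rule card_UN_le[OF fP])
  then have "card (\<Union>p\<in>P. (!) p ` {t. t < length p \<and> k dvd Suc t}) * k \<le> (\<Sum>p\<in>P. card (X p) * k)"
    unfolding sum_distrib_right[symmetric] by (rule mult_right_mono) simp
  also have "\<dots> \<le> (\<Sum>p\<in>P. card (set p))"
  proof (rule sum_mono)
    fix p assume p: "p \<in> P"
    have "{t. t < length p \<and> k dvd Suc t} \<subseteq> (\<lambda>j. j * k - 1) ` {1..length p div k}"
    proof
      fix t assume t: "t \<in> {t. t < length p \<and> k dvd Suc t}"
      define j where "j = Suc t div k"
      have j: "Suc t = j * k" using t by (simp add: j_def)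
      then have "j \<noteq> 0" by (metis mult_zero_left nat.distinct(1))
      moreover have "j \<le> length p div k" using t by (simp add: j_def div_le_mono)
      moreover have "t = j * k - 1" using j by simp
      ultimately show "t \<in> (\<lambda>j. j * k - 1) ` {1..length p div k}" by auto
    qed
    then have "card {t. t < length p \<and> k dvd Suc t} \<le> card ((\<lambda>j. j * k - 1) ` {1..length p div k})"
      by (intro card_mono) auto
    also have "\<dots> \<le> length p div k" using card_image_le[of "{1..length p div k}" "\<lambda>j. j * k - 1"] by simp
    finally have "card (X p) \<le> length p div k"
      unfolding X_def using card_image_le[of "{t. t < length p \<and> k dvd Suc t}" "(!) p"] by simp
    then have "card (X p) * k \<le> length p div k * k" by simp
    also have "\<dots> \<le> length p" by simp
    finally show "card (X p) * k \<le> card (set p)" using dp[OF p] by (simp add: distinct_card)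
  qed
  also have "\<dots> = card (\<Union>p\<in>P. set p)"
    using fP dj by (intro card_UN_disjoint[symmetric]) auto
  finally show ?thesis using cov by simp
qed

text \<open>Flexible edges have weight 2 changed by at most 1, which stays within
  \<open>{1..K}\<close> as \<open>K >= 3\<close>. At \<open>v\<close> the changes it owns add up to
  the sum of \<open>g v w\<close>, and those passing through it as a middle vertex cancel by the
  column condition on \<open>g\<close>.\<close>

lemma adjusted_weights:
  fixes V :: "'a set" and N :: "'a \<Rightarrow> 'a set" and F :: "'a \<Rightarrow> 'a \<Rightarrow> bool" and g :: "'a \<Rightarrow> 'a \<Rightarrow> int"
    and hv :: "'a \<Rightarrow> 'a \<Rightarrow> bool" and K :: nat
  assumes fV: "finite V" and NV: "\<And>v. N v \<subseteq> V" and sym: "\<And>u v. u \<in> N v \<longleftrightarrow> v \<in> N u" and K: "3 \<le> K"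
    and F: "\<And>v w. F v w \<Longrightarrow> \<not> F w v" and hv: "\<And>u v. hv u v \<longleftrightarrow> hv v u"
    and g1: "\<And>v w. g v w \<in> {-1, 0, 1}" and g2: "\<And>v w. g v w \<noteq> 0 \<Longrightarrow> w \<in> N v \<and> F v w"
    and g3: "\<And>w. (\<Sum>v\<in>V. g v w) = 0"
  shows "\<exists>wt :: 'a \<Rightarrow> 'a \<Rightarrow> nat. (\<forall>u v. wt u v = wt v u) \<and> (\<forall>u v. wt u v \<in> {1..K}) \<and>
     (\<forall>v. int (\<Sum>u\<in>N v. wt u v) =
       2 * int (card {w \<in> N v. F v w \<or> F w v}) + int (card {w \<in> N v. \<not> (F v w \<or> F w v)}) +
       int (K - 1) * int (card {u \<in> {w \<in> N v. \<not> (F v w \<or> F w v)}. hv u v}) + (\<Sum>w\<in>V. g v w))"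
proof -
  \<comment> \<open>A flexible edge is changed by the end that owns it; asymmetry of
    \<open>F\<close> makes the owner unique and \<open>wi\<close> symmetric.\<close>
  define wi where "wi u v = (if F u v then 2 + g u v else if F v u then 2 + g v u
      else if hv u v then int K else 1)" for u v
  have wi_sym: "wi u v = wi v u" for u v using F[of u v] hv[of u v] by (simp add: wi_def)
  have wi_rng: "1 \<le> wi u v \<and> wi u v \<le> int K" for u v
    using g1[of u v] g1[of v u] K by (auto simp: wi_def)
  have sum: "(\<Sum>u\<in>N v. wi u v) =
       2 * int (card {w \<in> N v. F v w \<or> F w v}) + int (card {w \<in> N v. \<not> (F v w \<or> F w v)}) +
       int (K - 1) * int (card {u \<in> {w \<in> N v. \<not> (F v w \<or> F w v)}. hv u v}) + (\<Sum>w\<in>V. g v w)" for v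
  proof -
    have fN: "finite (N v)" using NV fV finite_subset by blast
    have gF: "g u w = 0" if "\<not> F u w" for u w using g2 that by blast
    \<comment> \<open>A heavy edge counts as 1 plus \<open>K - 1\<close>, so that light and heavy
      ordinary edges share the base term.\<close>
    have tm: "wi u v = 2 * of_bool (F v u \<or> F u v) + of_bool (\<not> (F v u \<or> F u v)) +
        int (K - 1) * of_bool (\<not> (F v u \<or> F u v) \<and> hv u v) + g v u + g u v" for u
      using F[of u v] gF[of u v] gF[of v u] K by (auto simp: wi_def of_nat_diff)
    have 1: "(\<Sum>u\<in>N v. wi u v) = 2 * (\<Sum>u\<in>N v. of_bool (F v u \<or> F u v)) + (\<Sum>u\<in>N v. of_bool (\<not> (F v u \<or> F u v))) +
        int (K - 1) * (\<Sum>u\<in>N v. of_bool (\<not> (F v u \<or> F u v) \<and> hv u v)) + (\<Sum>u\<in>N v. g v u) + (\<Sum>u\<in>N v. g u v)"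
      unfolding tm sum.distrib sum_distrib_left ..
    have 2: "(\<Sum>u\<in>N v. of_bool (Q u)) = int (card {u \<in> N v. Q u})" for Q
      using fN by (simp add: Int_def)
    have 3: "{u \<in> {w \<in> N v. \<not> (F v w \<or> F w v)}. hv u v} = {u \<in> N v. \<not> (F v u \<or> F u v) \<and> hv u v}" by auto
    have 4: "(\<Sum>u\<in>N v. g v u) = (\<Sum>u\<in>V. g v u)"
      by (rule sum.mono_neutral_left[OF fV NV]) (use g2 in blast)
    have 5: "(\<Sum>u\<in>N v. g u v) = (\<Sum>u\<in>V. g u v)"
      by (rule sum.mono_neutral_left[OF fV NV]) (use g2 sym in blast)
    show ?thesis unfolding 1 2 3 4 5 g3 by simp
  qed
  define wt where "wt u v = nat (wi u v)" for u v
  have wt: "int (wt u v) = wi u v" for u v using wi_rng[of u v] by (simp add: wt_def)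
  have "wt u v = wt v u" "wt u v \<in> {1..K}" for u v
    using wi_sym[of u v] wi_rng[of u v] by (auto simp: wt_def)
  moreover have "int (\<Sum>u\<in>N v. wt u v) = (\<Sum>u\<in>N v. wi u v)" for v by (simp add: wt)
  ultimately show ?thesis unfolding sum[symmetric] by (intro exI[of _ wt]) blast
qed

text \<open>Here \<open>t\<close> is the deviation bound of both labellings. By \<open>t_low\<close>
  the reserved slots and the rounding of \<open>D0\<close> cost at most \<open>K * t\<close>; by
  \<open>t_up\<close> the flexible codegrees, of order \<open>e^2 * n / K^3\<close>, exceed the
  displacements to be transferred, of order \<open>K * t / e\<close>.\<close>

lemma dense_graph_weighting:
  fixes V :: "'a set" and N :: "'a \<Rightarrow> 'a set" and K n :: nat and e t :: real
  assumes fV: "finite V" and NV: "\<And>v. N v \<subseteq> V" and sym: "\<And>u v. u \<in> N v \<longleftrightarrow> v \<in> N u" and K: "3 \<le> K"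
    and n: "n = card V" and e: "0 < e" "e < 1"
    and deg: "\<And>v. v \<in> V \<Longrightarrow> (1 / (real K - 1) + e) * n \<le> card (N v)"
    and t: "t = 2 * sqrt (n * (5 * ln n))"
    and nK: "real K^4 < n" and t_low: "25 * real K * sqrt n \<le> t" and t_up: "100000 * real K^4 * t \<le> e^3 * n"
  shows "\<exists>wt :: 'a \<Rightarrow> 'a \<Rightarrow> nat. (\<forall>u v. wt u v = wt v u) \<and> (\<forall>u v. wt u v \<in> {1..K}) \<and>
           inj_on (\<lambda>v. \<Sum>u\<in>N v. wt u v) V"
proof -
  have K3: "real K \<ge> 3" using K by simp
  have K2: "real K^2 \<ge> 9" using power_mono[OF K3, of 2] by simp
  have K4: "real K^4 \<ge> 81" using power_mono[OF K3, of 4] by simp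
  have KK4: "real K \<le> real K^4" using K3 power_increasing[of 1 4 "real K"] by simp
  have n81: "real n > 81" using nK K4 by linarith
  have V0: "V \<noteq> {}" using n n81 by auto
  have sn: "sqrt n > 9" using n81 by (intro real_less_rsqrt) simp
  have snK: "sqrt n \<ge> real K^2"
    using nK by (intro real_le_rsqrt) simp
  have t_big: "t \<ge> 25 * real K * 9"
  proof -
    have "25 * real K * 9 \<le> 25 * real K * sqrt n" using sn by (intro mult_left_mono) auto
    then show ?thesis using t_low by linarith
  qed
  have t1: "t \<ge> 675" using t_big K3 by simp
  have e2: "e^3 \<le> e" "e^3 \<le> 1"
    using e power_decreasing[of 1 3 e] power_le_one[of e 3] by auto
  have Kt: "t \<le> real K * t" using K3 t1 by simp
  have KtK4: "real K * t \<le> real K^4 * t" using KK4 t1 by (intro mult_right_mono) auto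
  have en: "100000 * (real K * t) \<le> e * n"
  proof -
    have "e^3 * n \<le> e * n" using e2 by (intro mult_right_mono) auto
    then show ?thesis using t_up KtK4 by linarith
  qed
  have en_n: "e * n \<le> n" using e by (simp add: mult_left_le_one_le)
  \<comment> \<open>\<open>exp L = n^5\<close> is at least twice the number of tests in either
    labelling.\<close>
  define L where "L = 5 * ln n"
  have L0: "0 < L" using n81 by (simp add: L_def)
  have Ln: "L \<le> n"
  proof -
    have "t \<le> n" using en en_n Kt t1 by linarith
    then have "t^2 \<le> real n^2" using t1 by (intro power_mono) auto
    moreover have "t^2 = 4 * (n * L)" using L0 by (simp add: t L_def power_mult_distrib)
    ultimately have "real n * (4 * L) \<le> real n * real n" by (simp add: power2_eq_square)
    then have "4 * L \<le> n" using n81 by (simp add: mult_le_cancel_left_pos)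
    then show ?thesis using L0 by linarith
  qed
  have expL: "exp L = real n^5"
    using n81 exp_of_nat_mult[of 5 "ln (real n)"] by (simp add: L_def)

  \<comment> \<open>With \<open>q >= 8 / e\<close> at most \<open>2 * n / q + t <= e * n / 2\<close>
    edges at a vertex are flexible, while \<open>q <= 9 / e\<close> keeps the flexible codegrees of
    order \<open>e^2 * n\<close>.\<close>
  define q where "q = nat \<lceil>8 / e\<rceil>"
  have q_low: "8 / e \<le> q" using e by (simp add: q_def of_nat_nat)
  have q_up: "q \<le> 9 / e"
  proof -
    have "real q \<le> 8 / e + 1" using e by (simp add: q_def of_nat_nat)
    moreover have "1 \<le> 1 / e" using e by simp
    ultimately show ?thesis by (simp add: field_simps)
  qed
  have q0: "0 < q" using q_low e by (metis divide_pos_pos gr0I of_nat_0 not_le zero_less_numeral)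
  have qn: "real q \<le> n"
  proof -
    have "9 \<le> e * n" using en Kt t1 by linarith
    then have "9 / e \<le> n" using e by (simp add: field_simps)
    then show ?thesis using q_up by linarith
  qed
  have tL: "t = 2 * sqrt (real (card V) * L)" by (simp add: t L_def n)
  have q28: "28 * real (card V)^2 * real q^2 \<le> exp L"
  proof -
    have "28 * real n^2 * real q^2 \<le> n * real n^2 * real n^2"
      using qn n81 by (intro mult_mono power_mono) auto
    also have "\<dots> = exp L" by (simp add: expL numeral_eq_Suc)
    finally show ?thesis unfolding n .
  qed
  have LV: "L \<le> real (card V)" using Ln by (simp add: n)
  from exists_flexible_orientation[OF fV V0 NV q0 q28 L0 LV, folded tL, folded n]
  obtain F where F: "(\<forall>v w. F v w \<longrightarrow> \<not> F w v) \<and>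
           (\<forall>v\<in>V. real (card {w \<in> N v. F v w \<or> F w v}) \<le> 2 * real n / q + t) \<and>
           (\<forall>u\<in>V. \<forall>v\<in>V. real (card (N u \<inter> N v)) / (7 * real q^2) - t
                \<le> real (card {w \<in> N u \<inter> N v. F u w \<and> F v w}))" by (rule exE)
  have F1: "\<And>v w. F v w \<Longrightarrow> \<not> F w v" using F by blast
  have F2: "\<And>v. v \<in> V \<Longrightarrow> real (card {w \<in> N v. F v w \<or> F w v}) \<le> 2 * real n / q + t" using F by blast
  have F3: "\<And>u v. u \<in> V \<Longrightarrow> v \<in> V \<Longrightarrow> real (card (N u \<inter> N v)) / (7 * real q^2) - t
                \<le> real (card {w \<in> N u \<inter> N v. F u w \<and> F v w})" using F by blast
  define fl where "fl v = {w \<in> N v. F v w \<or> F w v}" for v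
  define N0 where "N0 v = {w \<in> N v. \<not> (F v w \<or> F w v)}" for v
  have fN: "finite (N v)" for v using NV fV finite_subset by blast
  have N0V: "N0 v \<subseteq> V" for v using NV by (auto simp: N0_def)
  have cN: "card (fl v) + card (N0 v) = card (N v)" for v
  proof -
    have "N v = fl v \<union> N0 v" "fl v \<inter> N0 v = {}" by (auto simp: fl_def N0_def)
    moreover have "finite (fl v)" "finite (N0 v)" using fN by (auto simp: fl_def N0_def)
    ultimately show ?thesis using card_Un_disjoint[of "fl v" "N0 v"] by simp
  qed
  have cNn: "card (N v) \<le> n" for v using NV fV by (simp add: n card_mono)
  have flb: "real (card (fl v)) \<le> e * n / 2" if "v \<in> V" for v
  proof -
    have "8 \<le> e * q" using q_low e by (simp add: field_simps)
    then have "8 * (2 * real n) \<le> (e * q) * (2 * real n)" by (intro mult_right_mono) auto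
    then have "2 * real n / q \<le> e * n / 4" using q0 by (simp add: field_simps)
    moreover have "t \<le> e * n / 4" using en Kt t1 by linarith
    ultimately show ?thesis using F2[OF that] by (simp add: fl_def)
  qed
  \<comment> \<open>Half of the excess \<open>e * n\<close> survives the removal of flexible edges,
    and it is multiplied by \<open>K - 1 >= 2\<close>.\<close>
  have degN0: "(1 + e) * n \<le> real (K - 1) * card (N0 v)" if "v \<in> V" for v
  proof -
    have "(1 / (real K - 1) + e) * n - e * n / 2 \<le> card (N0 v)"
      using deg[OF that] flb[OF that] cN[of v] by linarith
    then have "(real K - 1) * ((1 / (real K - 1) + e) * n - e * n / 2) \<le> (real K - 1) * card (N0 v)"
      using K3 by (intro mult_left_mono) auto
    also have "(real K - 1) * ((1 / (real K - 1) + e) * n - e * n / 2) = n + (real K - 1) * (e * n / 2)"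
      using K3 by (simp add: field_simps)
    finally have "n + (real K - 1) * (e * n / 2) \<le> (real K - 1) * card (N0 v)" .
    moreover have "2 * (e * n / 2) \<le> (real K - 1) * (e * n / 2)" using K3 e by (intro mult_right_mono) auto
    moreover have "(1 + e) * n = n + e * n" "real (K - 1) = real K - 1"
      using K by (auto simp: algebra_simps)
    ultimately show ?thesis by simp
  qed

  \<comment> \<open>Two vertices are adjacent in \<open>H\<close> if they have enough common
    neighbours to exchange units.\<close>
  define H where "H u v \<longleftrightarrow> u \<in> V \<and> v \<in> V \<and> u \<noteq> v \<and> real n / real K^3 \<le> real (card (N u \<inter> N v))" for u v
  have deg': "real (card V) / (real K - 1) \<le> real (card (N v))" if "v \<in> V" for v
  proof -
    have "(1 / (real K - 1) + e) * n = real n / (real K - 1) + e * n" by (simp add: distrib_right)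
    moreover have "0 \<le> e * n" using e by simp
    ultimately show ?thesis using deg[OF that] by (simp add: n)
  qed
  have "\<exists>P. path_system H V P \<and> card P < K \<and> (\<forall>p\<in>P. 2 \<le> length p)"
  proof (rule path_cover[OF fV])
    show "H y x" if "H x y" for x y using that by (auto simp: H_def Int_commute)
    show "\<exists>x\<in>A. \<exists>y\<in>A. H x y" if "A \<subseteq> V" "card A = K" for A
      using exists_large_codegree[OF fV V0 NV _ that deg'] K that(1) unfolding H_def n by fastforce
    show "K \<le> card {u. H v u}" if "v \<in> V" for v
    proof -
      have "{u. H v u} = {u \<in> V. v \<noteq> u \<and> real (card V) / real K^3 \<le> real (card (N v \<inter> N u))}"
        using that by (auto simp: H_def n)
      then show ?thesis using card_large_codegree[OF fV NV sym _ that deg'] K nK by (simp add: n)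
    qed
  qed (use K in \<open>auto simp: H_def\<close>)
  then obtain P where P: "path_system H V P" "card P < K" and len: "\<And>p. p \<in> P \<Longrightarrow> 2 \<le> length p" by blast

  \<comment> \<open>At least \<open>2 / e\<close>, so that \<open>R\<close> has at most
    \<open>e * n / 2\<close> vertices and the two extra slots of each fit into the gap between
    density \<open>1 / (1 + e)\<close> and 1.\<close>
  define k where "k = nat \<lceil>2 / e\<rceil>"
  have k_low: "2 / e \<le> k" using e by (simp add: k_def of_nat_nat)
  have k_up: "k \<le> 3 / e"
  proof -
    have "real k \<le> 2 / e + 1" using e by (simp add: k_def of_nat_nat)
    moreover have "1 \<le> 1 / e" using e by simp
    ultimately show ?thesis by (simp add: field_simps)
  qed
  have k0: "0 < k" using k_low e by (metis divide_pos_pos gr0I of_nat_0 not_le zero_less_numeral)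
  define R where "R = (\<Union>p\<in>P. (!) p ` {t. t < length p \<and> k dvd Suc t})"
  have RV: "R \<subseteq> V" using P(1) by (auto simp: R_def path_system_def)
  have cR: "2 * (real (card R) / n) \<le> e"
  proof -
    have "card R * k \<le> n" using card_spaced_vertices[OF P(1) k0] by (simp add: R_def n)
    then have "real (card R) * k \<le> n" by (metis of_nat_le_iff of_nat_mult)
    moreover have "real (card R) * (2 / e) \<le> real (card R) * k" using k_low by (intro mult_left_mono) auto
    ultimately have "real (card R) * (2 / e) \<le> n" by linarith
    then show ?thesis using e n81 by (simp add: field_simps)
  qed

  \<comment> \<open>The part of the weighted degree that does not depend on the labels
    \<open>x\<close>: 2 for a flexible edge, 1 for any other.\<close>
  define c where "c v = 2 * int (card (fl v)) + int (card (N0 v))" for v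
  have "\<exists>x :: 'a \<Rightarrow> nat. \<forall>A\<in>{V, R}. \<forall>a b. a \<le> b \<longrightarrow>
     real (card {v \<in> A. a \<le> c v + int (K - 1) * int (card {u \<in> N0 v. n \<le> x u + x v + 1}) \<and>
                       c v + int (K - 1) * int (card {u \<in> N0 v. n \<le> x u + x v + 1}) \<le> b})
       \<le> card A / n * (b - a) / (1 + e) + 2 * (K - 1) * t + t + 1"
    unfolding tL n
  proof (rule exists_spread_values[OF fV V0 RV N0V])
    show "(1 + e) * real (card V) \<le> real (K - 1) * real (card (N0 v))" if "v \<in> V" for v
      using degN0[OF that] n by simp
    show "0 \<le> c v \<and> c v + int (K - 1) * int (card (N0 v)) \<le> int (K * n)" for v
    proof -
      have "c v + int (K - 1) * int (card (N0 v)) = 2 * int (card (fl v)) + int K * int (card (N0 v))"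
        using K by (simp add: c_def of_nat_diff algebra_simps)
      also have "\<dots> \<le> int K * int (card (fl v)) + int K * int (card (N0 v))"
        using K by (intro add_right_mono mult_right_mono) auto
      also have "\<dots> = int K * int (card (N v))" using cN[of v] by (metis distrib_left of_nat_add)
      also have "\<dots> \<le> int K * int n" using cNn[of v] by (intro mult_left_mono) auto
      finally show ?thesis by (simp add: c_def)
    qed
    show "2 * ((real (card V))\<^sup>2 + 2 * (real (K * n) + 1)\<^sup>2) \<le> exp L"
    proof -
      have "real (K * n) + 1 \<le> 2 * (real K * real n)" using K3 n81 mult_mono[of 1 "real K" 1 "real n"] by simp
      then have "(real (K * n) + 1)^2 \<le> (2 * (real K * real n))^2" by (intro power_mono) auto
      also have "\<dots> = 4 * (real K^2 * real n^2)" by (simp add: power_mult_distrib)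
      finally have le: "(real (K * n) + 1)^2 \<le> 4 * (real K^2 * real n^2)" .
      define y where "y = (real (K * n) + 1)^2"
      have "2 * (real n^2 + 2 * y) \<le> 2 * real n^2 + 16 * (real K^2 * real n^2)"
        using le unfolding y_def[symmetric] by simp
      also have "2 * real n^2 \<le> 2 * (real K^2 * real n^2)"
        using K2 n81 by (intro mult_left_mono mult_le_cancel_right1[THEN iffD2]) auto
      also have "2 * (real K^2 * real n^2) + 16 * (real K^2 * real n^2) = (18 * real K^2) * real n^2" by simp
      also have "\<dots> \<le> (n * real n^2) * real n^2"
      proof (intro mult_right_mono)
        have "real K^2 \<le> real K^4" using K3 by (intro power_increasing) auto
        then have "real K^2 \<le> n" using nK by linarith
        moreover have "real n \<le> real n^2" using n81 by (simp add: power2_eq_square)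
        ultimately have "real K^2 \<le> real n^2" by linarith
        moreover have "18 \<le> real n" using n81 by simp
        ultimately show "18 * real K^2 \<le> n * real n^2" by (intro mult_mono) simp_all
      qed simp
      also have "\<dots> = exp L" by (simp add: expL numeral_eq_Suc)
      finally have "2 * (real n^2 + 2 * y) \<le> exp L" by simp
      then show ?thesis unfolding y_def n .
    qed
  qed (use e K L0 Ln n in auto)
  then obtain x :: "'a \<Rightarrow> nat" where x: "\<And>A a b. A \<in> {V, R} \<Longrightarrow> a \<le> b \<Longrightarrow>
     real (card {v \<in> A. a \<le> c v + int (K - 1) * int (card {u \<in> N0 v. n \<le> x u + x v + 1}) \<and>
                       c v + int (K - 1) * int (card {u \<in> N0 v. n \<le> x u + x v + 1}) \<le> b})
       \<le> card A / n * (b - a) / (1 + e) + 2 * (K - 1) * t + t + 1"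
    by blast
  define \<sigma> where "\<sigma> v = c v + int (K - 1) * int (card {u \<in> N0 v. n \<le> x u + x v + 1})" for v
  have spread: "real (card {v \<in> A. a \<le> \<sigma> v \<and> \<sigma> v \<le> b}) \<le> card A / n * ((b - a) / (1 + e)) + 2 * (real K * t)"
    if "A \<in> {V, R}" "a \<le> b" for A a b
  proof -
    have "2 * (K - 1) * t + t + 1 \<le> 2 * (real K * t)" using t1 K by (simp add: of_nat_diff algebra_simps)
    then show ?thesis using x[OF that] unfolding \<sigma>_def by (simp add: algebra_simps)
  qed

  \<comment> \<open>\<open>D0\<close> collects the errors \<open>2 * K * t\<close> of three counts,
    and \<open>D\<close> leaves a further \<open>K * t\<close> for the reserved slots.
    \<open>W = k * D\<close> lets a jump offset the drift over \<open>k\<close> steps. The step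
    \<open>B\<close>, about \<open>sqrt n\<close>, balances the \<open>O(W / B)\<close> values
    reserved for the penultimate vertex of a path, beyond a term \<open>O(K)\<close>, against the
    \<open>O(K * B)\<close> values for the last.\<close>
  define D0 where "D0 = \<lceil>6 * (real K * t)\<rceil>"
  define D where "D = \<lceil>7 * (real K * t)\<rceil>"
  define W where "W = int k * D"
  define B where "B = \<lceil>sqrt n\<rceil>"
  define J where "J = nat \<lceil>3 * W / B\<rceil> + 4 * K"
  have Kt0: "real K * t \<ge> 1" using Kt t1 by linarith
  have D0b: "real_of_int D0 \<ge> 6 * (real K * t)" "real_of_int D0 \<le> 6 * (real K * t) + 1" unfolding D0_def by linarith+
  have Db: "real_of_int D \<ge> 7 * (real K * t)" "real_of_int D \<le> 8 * (real K * t)" unfolding D_def using Kt0 by linarith+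
  have Bb: "real_of_int B \<ge> sqrt n" "real_of_int B \<le> sqrt n + 1" unfolding B_def by linarith+
  have B0: "0 < B" using Bb(1) sn by (smt (verit) of_int_0_less_iff)
  have Dp: "0 \<le> D" using Db(1) Kt0 by linarith
  have WD: "D \<le> W"
  proof -
    have "1 * D \<le> int k * D" using k0 Dp by (intro mult_right_mono) auto
    then show ?thesis by (simp add: W_def)
  qed
  have Wup: "real_of_int W \<le> 24 * (real K * t) / e"
  proof -
    have "real k * real_of_int D \<le> (3 / e) * (8 * (real K * t))" using k_up Db Kt0 e by (intro mult_mono) auto
    then show ?thesis by (simp add: W_def)
  qed
  have Wn: "real_of_int W \<le> real n"
  proof -
    have "24 * (real K * t) \<le> e * n" using en Kt0 by linarith
    then have "24 * (real K * t) / e \<le> n" using e by (simp add: field_simps)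
    then show ?thesis using Wup by linarith
  qed
  have count: "int (card {v\<in>V. a \<le> \<sigma> v \<and> \<sigma> v \<le> b}) +
        int (card {v\<in>R. a \<le> \<sigma> v - W \<and> \<sigma> v - W \<le> b}) +
        int (card {v\<in>R. a \<le> \<sigma> v + W \<and> \<sigma> v + W \<le> b}) \<le> b - a + D0" if ab: "a \<le> b" for a b
  proof -
    define w where "w = (real_of_int b - real_of_int a) / (1 + e)"
    have w0: "0 \<le> w" using ab e by (simp add: w_def)
    have 1: "real (card {v\<in>V. a \<le> \<sigma> v \<and> \<sigma> v \<le> b}) \<le> w + 2 * (real K * t)"
      using spread[of V a b] ab n81 by (simp add: w_def n)
    have "{v\<in>R. a \<le> \<sigma> v - W \<and> \<sigma> v - W \<le> b} = {v\<in>R. a + W \<le> \<sigma> v \<and> \<sigma> v \<le> b + W}" by auto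
    then have 2: "real (card {v\<in>R. a \<le> \<sigma> v - W \<and> \<sigma> v - W \<le> b}) \<le> card R / n * w + 2 * (real K * t)"
      using spread[of R "a + W" "b + W"] ab by (simp add: w_def)
    have "{v\<in>R. a \<le> \<sigma> v + W \<and> \<sigma> v + W \<le> b} = {v\<in>R. a - W \<le> \<sigma> v \<and> \<sigma> v \<le> b - W}" by auto
    then have 3: "real (card {v\<in>R. a \<le> \<sigma> v + W \<and> \<sigma> v + W \<le> b}) \<le> card R / n * w + 2 * (real K * t)"
      using spread[of R "a - W" "b - W"] ab by (simp add: w_def)
    \<comment> \<open>The three counts together have density at most
      \<open>(1 + e) / (1 + e) = 1\<close>.\<close>
    have "2 * (card R / n) * w \<le> e * w" using cR w0 by (rule mult_right_mono)
    then have "w + 2 * (card R / n * w) \<le> (1 + e) * w" by (simp add: algebra_simps)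
    also have "\<dots> = real_of_int b - real_of_int a" using e by (simp add: w_def)
    finally have "real (card {v\<in>V. a \<le> \<sigma> v \<and> \<sigma> v \<le> b}) + real (card {v\<in>R. a \<le> \<sigma> v - W \<and> \<sigma> v - W \<le> b}) +
        real (card {v\<in>R. a \<le> \<sigma> v + W \<and> \<sigma> v + W \<le> b}) \<le> real_of_int (b - a + D0)"
      unfolding of_int_diff of_int_add using 1 2 3 D0b(1) by argo
    then show ?thesis by linarith
  qed
  have JB: "3 * W + 4 * int K * B \<le> int J * B"
  proof -
    have "3 * W / B \<le> \<lceil>3 * W / B\<rceil>" by linarith
    then have "real_of_int (3 * W) \<le> \<lceil>3 * W / B\<rceil> * real_of_int B" 
      using B0 by (subst (asm) pos_divide_le_eq) auto
    then have "3 * W \<le> \<lceil>3 * W / B\<rceil> * B" by (metis of_int_le_iff of_int_mult)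
    also have "\<dots> \<le> int (nat \<lceil>3 * W / B\<rceil>) * B" using B0 by (intro mult_right_mono) auto
    finally show ?thesis by (simp add: J_def algebra_simps)
  qed
  have W0: "0 \<le> W" using WD Db(1) Kt0 by linarith
  have Jup: "real J \<le> 3 * sqrt n + 1 + 4 * real K"
  proof -
    have "3 * W / B \<le> 3 * real n / sqrt n"
      using Wn W0 Bb sn n81 by (intro frac_le) auto
    also have "\<dots> = 3 * (real n / sqrt n)" by simp
    also have "\<dots> = 3 * sqrt n" by (subst real_div_sqrt) simp_all
    finally have "\<lceil>3 * W / B\<rceil> \<le> 3 * sqrt n + 1" by linarith
    moreover have "0 \<le> 3 * W / B" using W0 B0 by (intro divide_nonneg_nonneg) auto
    then have "0 \<le> \<lceil>3 * W / B\<rceil>" by linarith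
    ultimately show ?thesis by (simp add: J_def)
  qed
  have KsnK: "12 * real K \<le> 4 * sqrt n"
  proof -
    have "3 * real K \<le> real K * K" using K3 by (intro mult_right_mono) auto
    then show ?thesis using snK by (simp add: power2_eq_square)
  qed
  have Kt_low: "25 * (real K * (real K * sqrt n)) \<le> real K * t"
    using mult_left_mono[OF t_low, of "real K"] by (simp add: algebra_simps)
  have Ksn: "3 * sqrt n \<le> K * sqrt n" using K3 sn by (intro mult_right_mono) auto
  have D: "D0 + int K * (2 * int J + 1 + (4 * int K * B + 1)) \<le> D"
  proof -
    have KB: "real K * real_of_int B \<le> real K * (sqrt n + 1)" using Bb by (intro mult_left_mono) auto
    have "2 * real J + 1 + (4 * (real K * real_of_int B) + 1) \<le> 2 * (3 * sqrt n + 1 + 4 * real K) + 2 + 4 * (K * (sqrt n + 1))"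
      using Jup KB by (linarith | argo)
    also have "\<dots> = 6 * sqrt n + 4 + 12 * real K + 4 * (K * sqrt n)" by (simp add: algebra_simps)
    also have "\<dots> \<le> 11 * sqrt n + 4 * (K * sqrt n)" using KsnK sn by (linarith | argo)
    also have "\<dots> \<le> 24 * (K * sqrt n)" using Ksn sn by (linarith | argo)
    finally have "K * (2 * real J + 1 + (4 * (real K * real_of_int B) + 1)) \<le> K * (24 * (K * sqrt n))"
      by (rule mult_left_mono) simp
    moreover have "1 \<le> real K * (real K * sqrt n)"
      using K3 sn n81 mult_mono[of 1 "real K" 1 "real K * sqrt n"] mult_mono[of 1 "real K" 1 "sqrt n"] by simp
    ultimately have "real_of_int D0 + real K * (2 * real J + 1 + (4 * (real K * real_of_int B) + 1)) \<le> D"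
      using D0b Db Kt_low by (linarith | argo)
    then have "real_of_int (D0 + int K * (2 * int J + 1 + (4 * int K * B + 1))) \<le> real_of_int D"
      by (simp add: algebra_simps)
    then show ?thesis by (linarith | argo)
  qed
  have W2: "4 * int K * B \<le> 3 * W"
  proof -
    have "4 * (real K * real_of_int B) \<le> 4 * (K * (sqrt n + 1))" using Bb by (intro mult_left_mono) auto
    also have "\<dots> \<le> 4 * (K * (2 * sqrt n))" using sn n81 by (intro mult_left_mono) auto
    also have "\<dots> = 8 * (1 * (K * sqrt n))" by simp
    also have "\<dots> \<le> 8 * (real K * (real K * sqrt n))" using K3 by (intro mult_left_mono mult_right_mono) auto
    also have "\<dots> \<le> 3 * real_of_int D" using Kt_low Db Kt0 by (linarith | argo)
    finally have "real_of_int (4 * int K * B) \<le> real_of_int (3 * D)" by (simp add: algebra_simps)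
    then show ?thesis using WD by (linarith | argo)
  qed
  have Jc: "2 * W + D + 4 * int K * B \<le> int J * B" using JB WD by (linarith | argo)
  have D00: "0 \<le> D0" using D0b(1) Kt0 by (linarith | argo)
  note targets = exists_targets[OF P(1) len less_imp_le[OF P(2)] fV k0 B0 D00 R_def count D _ W2 Jc]
  obtain f where f: "inj_on f V" and
    f1: "\<And>p i. p \<in> P \<Longrightarrow> \<bar>\<Sum>v\<leftarrow>take i p. f v - \<sigma> v\<bar> \<le> 3 * W" and
    f2: "\<And>p. p \<in> P \<Longrightarrow> (\<Sum>v\<leftarrow>p. f v - \<sigma> v) = 0"
    using targets W_def by blast

  \<comment> \<open>\<open>M\<close> bounds the running displacements; vertices adjacent in
    \<open>H\<close> must then share \<open>6 * W\<close> middle vertices.\<close>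
  define M where "M = nat (3 * W)"
  have M: "int M = 3 * W" using W0 by (simp add: M_def)
  define Mid where "Mid v = {w \<in> N v. F v w}" for v
  have MidV: "Mid v \<subseteq> V" for v using NV by (auto simp: Mid_def)
  have HM: "2 * M \<le> card (Mid u \<inter> Mid v)" if "H u v" for u v
  proof -
    have uv: "u \<in> V" "v \<in> V" "real n / real K^3 \<le> real (card (N u \<inter> N v))" using that by (auto simp: H_def)
    have q2: "real q^2 \<le> 81 / e^2"
    proof -
      have "real q^2 \<le> (9 / e)^2" using q_up by (intro power_mono) auto
      then show ?thesis by (simp add: power_divide)
    qed
    \<comment> \<open>\<open>567 = 7 * 81\<close> comes from \<open>7 * q^2 <= 567 / e^2\<close>,
      and \<open>176 * 567 <= 100000\<close>. Since \<open>6 * W <= 144 * K * t / e\<close>, there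
      is room for subtracting \<open>t\<close>.\<close>
    have "176 * (real K * t) / e \<le> n * e^2 / (567 * real K^3)"
    proof -
      have "0 \<le> real K^4 * t" using t1 by simp
      then have "176 * 567 * (real K^4 * t) \<le> 100000 * (real K^4 * t)" by (rule mult_right_mono[rotated]) simp
      also have "\<dots> \<le> e^3 * n" using t_up by (simp only: mult.assoc)
      finally have "176 * 567 * (real K^4 * t) \<le> e^3 * n" .
      then show ?thesis using e K3
        by (simp add: field_simps power4_eq_xxxx power3_eq_cube power2_eq_square)
    qed
    also have "\<dots> = (n / real K^3) / (7 * (81 / e^2))" using e K3 by (simp add: field_simps)
    also have "\<dots> \<le> real (card (N u \<inter> N v)) / (7 * real q^2)"
      using uv(3) q2 q0 e by (intro frac_le) auto
    finally have low: "176 * (real K * t) / e - t \<le> real (card {w \<in> N u \<inter> N v. F u w \<and> F v w})"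
      using F3[OF uv(1,2)] by (linarith | argo)
    have mid: "{w \<in> N u \<inter> N v. F u w \<and> F v w} = Mid u \<inter> Mid v" by (auto simp: Mid_def)
    define y where "y = (real K * t) / e"
    have ty: "t \<le> y"
    proof -
      have "real K * t * e \<le> real K * t" using e Kt0 by (simp add: mult_left_le)
      then have "real K * t \<le> y" using e by (simp add: y_def field_simps)
      then show ?thesis using Kt by linarith
    qed
    have Wy: "real_of_int W \<le> 24 * y" using Wup by (simp add: y_def)
    have "176 * (real K * t) / e = 176 * y" by (simp add: y_def)
    then have "176 * y - t \<le> real (card (Mid u \<inter> Mid v))" using low unfolding mid by simp
    then have "6 * real_of_int W \<le> real (card (Mid u \<inter> Mid v))" using Wy ty t1 by linarith
    moreover have "real (2 * M) = 6 * real_of_int W" 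
      using arg_cong[OF M, of real_of_int] by simp
    ultimately show ?thesis by (linarith | argo)
  qed
  have f1': "\<bar>\<Sum>v\<leftarrow>take i p. f v - \<sigma> v\<bar> \<le> int M" if "p \<in> P" for p i unfolding M by (rule f1[OF that])
  have transfer: "\<exists>g. (\<forall>v w. g v w \<in> {-1, 0, 1::int}) \<and>
           (\<forall>v w. g v w \<noteq> 0 \<longrightarrow> v \<in> V \<and> w \<in> Mid v) \<and>
           (\<forall>w. (\<Sum>v\<in>V. g v w) = 0) \<and> (\<forall>v\<in>V. (\<Sum>w\<in>V. g v w) = f v - \<sigma> v)"
    by (rule system_transfer[where Mid = Mid and M = M, OF fV _ P(1)]) (fact MidV HM f1' f2)+
  obtain g where g1: "\<And>v w. g v w \<in> {-1, 0, 1::int}"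
    and g2: "\<And>v w. g v w \<noteq> 0 \<Longrightarrow> w \<in> Mid v"
    and g3: "\<And>w. (\<Sum>v\<in>V. g v w) = 0" and g4: "\<And>v. v \<in> V \<Longrightarrow> (\<Sum>w\<in>V. g v w) = f v - \<sigma> v"
    using transfer by blast
  have "\<exists>wt :: 'a \<Rightarrow> 'a \<Rightarrow> nat. (\<forall>u v. wt u v = wt v u) \<and> (\<forall>u v. wt u v \<in> {1..K}) \<and>
     (\<forall>v. int (\<Sum>u\<in>N v. wt u v) = 2 * int (card (fl v)) + int (card (N0 v)) +
       int (K - 1) * int (card {u \<in> N0 v. n \<le> x u + x v + 1}) + (\<Sum>w\<in>V. g v w))"
    unfolding fl_def N0_def
  proof (rule adjusted_weights[where N = N and F = F, OF fV])
    show "n \<le> x u + x v + 1 \<longleftrightarrow> n \<le> x v + x u + 1" for u v by (simp add: add.commute)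
    show "w \<in> N v \<and> F v w" if "g v w \<noteq> 0" for v w using g2[OF that] by (simp add: Mid_def)
  qed (fact NV sym K F1 g1 g3)+
  then obtain wt :: "'a \<Rightarrow> 'a \<Rightarrow> nat" where wt: "\<forall>u v. wt u v = wt v u" "\<forall>u v. wt u v \<in> {1..K}"
    and wt3: "\<And>v. int (\<Sum>u\<in>N v. wt u v) = 2 * int (card (fl v)) + int (card (N0 v)) +
       int (K - 1) * int (card {u \<in> N0 v. n \<le> x u + x v + 1}) + (\<Sum>w\<in>V. g v w)"
    by blast
  \<comment> \<open>The labels contribute \<open>\<sigma> v\<close> and the transfers
    \<open>f v - \<sigma> v\<close>, so every vertex reaches its target.\<close>
  have "int (\<Sum>u\<in>N v. wt u v) = f v" if "v \<in> V" for v
    using wt3[of v] g4[OF that] by (simp add: \<sigma>_def c_def)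
  then have "inj_on (\<lambda>v. \<Sum>u\<in>N v. wt u v) V" using f by (smt (verit) inj_on_def)
  then show ?thesis using wt by blast
qed

section \<open>The choice of the constant and the passage to weightings of edge sets\<close>

theorem theorem3:
  fixes K :: nat
  assumes "K \<ge> 3"
  shows "\<exists>C::real. \<forall>(V :: 'a set) (E :: 'a set set) (n::nat).
           simple_graph V E \<longrightarrow> card V = n \<longrightarrow> n \<ge> 2 \<longrightarrow>
           real (min_degree V E) \<ge>
             (1 / (real K - 1) + C / ((real n / ln (real n)) powr (1/6))) * real n \<longrightarrow>
           irregularity_strength V E \<le> enat K"
proof -
  \<comment> \<open>The first summand yields the upper bound on \<open>t\<close>; the exponential
    makes \<open>ln n\<close> at least \<open>32 * K^2\<close>, which gives the lower bound.\<close>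
  define C where "C = 500000 * real K^4 + exp (32 * real K^2)"
  have K1: "real K^4 \<ge> 1" using assms by (simp add: one_le_power)
  have CK: "500000 * real K^4 \<le> C" and CE: "exp (32 * real K^2) \<le> C" by (auto simp: C_def)
  have C2: "C \<ge> 2" using CK K1 by linarith
  show ?thesis
  proof (intro exI[of _ C] allI impI)
    fix V :: "'a set" and E :: "'a set set" and n :: nat
    assume G: "simple_graph V E" and n: "card V = n" and n2: "n \<ge> 2"
      and delta: "real (min_degree V E) \<ge> (1 / (real K - 1) + C / ((real n / ln (real n)) powr (1/6))) * real n"
    have fV: "finite V" using G by (simp add: simple_graph_def)
    have NV: "neighbours E v \<subseteq> V" for v using G by (auto simp: simple_graph_def neighbours_def)
    have sym: "u \<in> neighbours E v \<longleftrightarrow> v \<in> neighbours E u" for u v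
      by (simp add: neighbours_def insert_commute)
    define r where "r = real n / ln (real n)"
    have lnp: "ln (real n) \<ge> 1 / 2"
    proof -
      have "exp (1 / 2 :: real) \<le> 2" using exp_bound[of "1 / 2"] by (simp add: power2_eq_square)
      then show ?thesis using n2 by (subst ln_ge_iff) auto
    qed
    have r: "r > 0" "r * ln (real n) = n" using lnp n2 by (auto simp: r_def)
    define e where "e = C / (r powr (1/6))"
    have e0: "e > 0" using C2 r by (simp add: e_def)
    have deg: "(1 / (real K - 1) + e) * n \<le> card (neighbours E v)" if "v \<in> V" for v
    proof -
      have "min_degree V E \<le> graph_degree E v"
        unfolding min_degree_def using fV that by (intro Min_le) auto
      then show ?thesis using delta by (simp add: graph_degree_def e_def r_def)
    qed
    \<comment> \<open>Degrees are at most \<open>n\<close>, so the hypothesis itself excludes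
      \<open>e >= 1\<close>. Graphs that are too small for \<open>C\<close> never satisfy it, and no
      separate case arises.\<close>
    have e1: "e < 1"
    proof -
      obtain v where v: "v \<in> V" using n n2 by (cases "V = {}") auto
      have "card (neighbours E v) \<le> n" using card_mono[OF fV NV] n by simp
      then have "(1 / (real K - 1) + e) * n \<le> 1 * real n" using deg[OF v] by simp
      then have "1 / (real K - 1) + e \<le> 1" using n2 by (subst (asm) mult_le_cancel_right_pos) auto
      moreover have "1 / (real K - 1) > 0" using assms by simp
      ultimately show ?thesis by linarith
    qed
    \<comment> \<open>From \<open>e < 1\<close> follows \<open>C^6 < n / ln n\<close>;
      \<open>ln n >= 1/2\<close> and \<open>C^5 >= 2\<close> turn this into
      \<open>C <= n\<close>.\<close>
    have "C < r powr (1/6)" using e1 r by (simp add: e_def)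
    then have "C^6 < (r powr (1/6))^6" using C2 by (intro power_strict_mono) auto
    also have "\<dots> = r" using r by (simp add: powr_realpow[symmetric] powr_powr)
    finally have "C^6 * (1/2) \<le> r * ln (real n)" using lnp C2 r by (intro mult_mono) auto
    moreover have "C \<le> C^6 * (1/2)"
    proof -
      have "2 \<le> C^5" using power_mono[of 2 C 5] C2 by simp
      then have "C * 2 \<le> C * C^5" using C2 by (intro mult_left_mono) auto
      then show ?thesis by (simp add: power_numeral_reduce)
    qed
    ultimately have nC: "C \<le> n" using r by linarith
    have nK: "real K^4 < n" using nC CK K1 by linarith
    have lnK: "32 * real K^2 \<le> ln (real n)"
      using CE nC n2 by (subst ln_ge_iff) auto
    define s where "s = sqrt (n * ln (real n))"
    define t where "t = 2 * sqrt (n * (5 * ln (real n)))"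
    have s0: "0 \<le> s" using lnp by (simp add: s_def)
    have ts: "t \<le> 5 * s"
    proof -
      have "t = 2 * sqrt (5 * (n * ln (real n)))" by (simp add: t_def algebra_simps)
      also have "\<dots> = (2 * sqrt 5) * s" unfolding s_def real_sqrt_mult[of 5] by simp
      also have "\<dots> \<le> 5 * s"
      proof (rule mult_right_mono[OF _ s0])
        have "sqrt 5 \<le> 5/2" by (rule real_le_lsqrt) (auto simp: power2_eq_square)
        then show "2 * sqrt 5 \<le> 5" by simp
      qed
      finally show ?thesis .
    qed
    have t_low: "25 * real K * sqrt n \<le> t"
    proof -
      have "25 * real K * sqrt n = sqrt ((25 * real K)^2 * n)" 
        by (simp only: real_sqrt_mult[of "(25 * real K)^2"] real_sqrt_abs)
      also have "\<dots> \<le> sqrt ((2^2) * (n * (5 * ln (real n))))"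
      proof (rule real_sqrt_le_mono)
        have "(25 * real K)^2 \<le> 20 * (32 * real K^2)" by (simp add: power2_eq_square)
        also have "\<dots> \<le> 20 * ln (real n)" using lnK by simp
        finally have "(25 * real K)^2 * n \<le> 20 * ln (real n) * n" by (rule mult_right_mono) simp
        then show "(25 * real K)^2 * n \<le> (2^2) * (n * (5 * ln (real n)))" by (simp add: mult.commute)
      qed
      also have "\<dots> = t" unfolding t_def real_sqrt_mult[of "2^2"] by simp
      finally show ?thesis .
    qed
    \<comment> \<open>\<open>e^3 = C^3 / sqrt (n / ln n)\<close>, hence
      \<open>e^3 * n = C^3 * sqrt (n * ln n)\<close>: the exponent 1/6 is what brings the cube to
      the scale of \<open>t\<close>.\<close>
    have t_up: "100000 * real K^4 * t \<le> e^3 * n"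
    proof -
      have "(r powr (1/6))^3 = sqrt r" using r by (simp add: powr_realpow[symmetric] powr_powr powr_half_sqrt)
      then have "e^3 * n = C^3 / sqrt r * (r * ln (real n))" using r(2) by (simp add: e_def power_divide)
      also have "\<dots> = C^3 * (r / sqrt r * ln (real n))" by simp
      also have "r / sqrt r = sqrt r" using r by (simp add: real_div_sqrt)
      also have "sqrt r * ln (real n) = s"
      proof -
        have "n * ln (real n) = (r * ln (real n)) * ln (real n)" by (simp only: r(2))
        also have "\<dots> = r * (ln (real n))^2" by (simp add: power2_eq_square)
        finally have "s = sqrt (r * (ln (real n))^2)" by (simp only: s_def)
        also have "\<dots> = sqrt r * ln (real n)" using lnp by (simp add: real_sqrt_mult)
        finally show ?thesis by simp
      qed
      finally have eq: "e^3 * n = C^3 * s" .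
      have "100000 * real K^4 * t \<le> 100000 * real K^4 * (5 * s)" using ts by (intro mult_left_mono) auto
      also have "\<dots> = 500000 * real K^4 * s" by simp
      also have "\<dots> \<le> C^3 * s"
      proof (rule mult_right_mono[OF _ s0])
        have "C \<le> C^3" using C2 power_increasing[of 1 3 C] by simp
        then show "500000 * real K^4 \<le> C^3" using CK by linarith
      qed
      finally show ?thesis using eq by simp
    qed
    obtain wt :: "'a \<Rightarrow> 'a \<Rightarrow> nat" where wt: "\<And>u v. wt u v = wt v u" "\<And>u v. wt u v \<in> {1..K}"
      and inj: "inj_on (\<lambda>v. \<Sum>u\<in>neighbours E v. wt u v) V"
      using dense_graph_weighting[OF fV NV sym assms n[symmetric] e0 e1 deg t_def nK t_low t_up] by blast
    \<comment> \<open>\<open>SOME\<close> picks an ordering of the two ends, harmless because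
      \<open>wt\<close> is symmetric; every value of \<open>\<omega>\<close> is a value of
      \<open>wt\<close> and so lies in \<open>{1..K}\<close>.\<close>
    define \<omega> where "\<omega> a = (case (SOME p. a = {fst p, snd p}) of (u, v) \<Rightarrow> wt u v)" for a
    have \<omega>: "\<omega> {u, v} = wt u v" for u v
    proof -
      define p where "p = (SOME p. {u, v} = {fst p, snd p})"
      have "{u, v} = {fst p, snd p}" unfolding p_def by (rule someI[of _ "(u, v)"]) simp
      then have "p = (u, v) \<or> p = (v, u)" by (auto simp: doubleton_eq_iff prod_eq_iff)
      then show ?thesis using wt(1)[of u v] by (auto simp: \<omega>_def p_def[symmetric])
    qed
    have "weighting E K \<omega>" using wt(2) by (auto simp: weighting_def \<omega>_def split: prod.splits)
    moreover have "inj_on (weighted_degree E \<omega>) V"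
      using inj by (simp add: weighted_degree_def \<omega> cong: inj_on_cong)
    ultimately show "irregularity_strength V E \<le> enat K"
      unfolding irregularity_strength_def using assms by (intro Inf_lower) auto
  qed
qed

end
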